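(* For every partial staircase $L\subset L_m$, the non-crossing complex $\mathbf m^{(nc)}_L$ triangulates $GT_L$; that is, every element $T$ of the cone $GT_L$ can be uniquely written as a positive linear combination of patterns $T_{p(I)}$, $I\in 2^{\mathbf m}_L$, in which the participating subsets $I$ form a face of $\mathbf m^{(nc)}_L$ (are pairwise non-crossing).
   Context: Shapes. Let $m\ge1$, $[m]=\{1,\dots,m\}$. The source is $(0,0)$; the sinks of the staircase $L_m$ are the points $(m-k,k)$, $0\le k\le m$. A partial staircase $L\subset L_m$ is given by a nonempty set of selected sinks (the sinks of $L$): its nodes are the $(x,y)\in\mathbb Z_{\ge0}^2$ with $x\le a$, $y\le b$ for some selected sink $(a,b)$, and its edges are the unit horizontal and vertical segments joining two nodes of $L$. For $I\subseteq[m]$, $p(I)$ is the lattice path from $(0,0)$ of length $m$ whose $t$-th step is north if $t\in I$ and east otherwise. $2^{\mathbf m}_L$ is the set of $I\subseteq [m]$ such that $p(I)$ is contained in $L$ (equivalently $(m-|I|,|I|)$ is a sink of $L$). Non-crossing rule. Two pairs $\{u<v\}$, $\{x<y\}$ of elements of $\mathbb Z\cup\{\infty\}$ are non-crossing if neither $x<u<y<v$ nor $u<x<v<y$ holds. Let $I=\{i_1<\dots<i_k\}$, $J=\{j_1<\dots<j_l\}$ be subsets of $[m]$ with $k\le l$. For every $s$ with $i_s=j_s$ remove $i_s$ from $I$ and $j_s$ from $J$, obtaining $I'=\{i'_1<\dots<i'_{k'}\}$ and $J'=\{j'_1<\dots<j'_{l'}\}$. $I$ and $J$ are non-crossing if (1)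 for all $1\le s\le k'-1$ the pairs $\{i'_s,i'_{s+1}\}$, $\{j'_s,j'_{s+1}\}$ are non-crossing, and (2) if $k'<l'$, the pairs $\{i'_{k'},\infty\}$, $\{j'_{k'},j'_{k'+1}\}$ are non-crossing (vacuous if $k'=0$). $\mathbf m^{(nc)}_L$ is the simplicial complex on vertex set $2^{\mathbf m}_L$ whose faces are the sets of pairwise non-crossing elements. Gelfand-Tsetlin patterns. Cells are unit squares of the grid $\mathbb Z^2$. A cell is a cell of $L$ if its northwest or its southeast corner is a node of $L$; it is internal if all four corners are nodes of $L$, and external otherwise. Two external cells are connected if they share a horizontal or vertical edge that is not an edge of $L$. A real-valued Gelfand-Tsetlin pattern of shape $L$ is a filling of the cells of $L$ with nonnegative reals, weakly increasing from west to east along rows and from north to south along columns, such that connected external cells have equal entries and the external cells to the west of $L$ (those in the column $-1\le x\le0$) contain $0$. $GT_L$ is the cone of these patterns. For a path $p$ in $L$ from the source to a sink of $L$ with north and east steps, $T_p\in GT_L$ has entry $1$ in the cells to the southeast of $p$ and $0$ in the cells to the northwest of $p$. *)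

theory Defs
  imports Complex_Main "HOL-Library.Extended_Nat"
begin

text \<open>
  Lattice points are pairs (x, y) of integers.  A partial staircase is represented by the
  set L of its selected sinks.
\<close>

type_synonym point = "int \<times> int"

definition staircase_sinks :: "nat \<Rightarrow> point set" where
  "staircase_sinks m = {(int m - int k, int k) | k. k \<le> m}"

definition partial_staircase :: "nat \<Rightarrow> point set \<Rightarrow> bool" where
  "partial_staircase m L \<longleftrightarrow> L \<noteq> {} \<and> L \<subseteq> staircase_sinks m"

definition nodes :: "point set \<Rightarrow> point set" where
  "nodes L = {(x, y). 0 \<le> x \<and> 0 \<le> y \<and> (\<exists>(a, b)\<in>L. x \<le> a \<and> y \<le> b)}"

definition edges :: "point set \<Rightarrow> point set set" where
  "edges L = {{(x, y), (x + 1, y)} | x y. (x, y) \<in> nodes L \<and> (x + 1, y) \<in> nodes L}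
           \<union> {{(x, y), (x, y + 1)} | x y. (x, y) \<in> nodes L \<and> (x, y + 1) \<in> nodes L}"


subsection \<open>Lattice paths and the sets they encode\<close>

definition path_node :: "nat set \<Rightarrow> nat \<Rightarrow> point" where
  "path_node I t = (int (card ({1..t} - I)), int (card ({1..t} \<inter> I)))"

definition lattice_path :: "nat \<Rightarrow> nat set \<Rightarrow> point set" where
  "lattice_path m I = path_node I ` {0..m}"

text \<open>
  Two nodes at distance one are always joined by an edge of L, so containment of a path
  in L only concerns its nodes.
\<close>

definition path_sets :: "nat \<Rightarrow> point set \<Rightarrow> nat set set" where
  "path_sets m L = {I. I \<subseteq> {1..m} \<and> lattice_path m I \<subseteq> nodes L}"


subsection \<open>The non-crossing complex\<close>

definition non_crossing_pairs :: "enat \<Rightarrow> enat \<Rightarrow> enat \<Rightarrow> enat \<Rightarrow> bool" where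
  "non_crossing_pairs u v x y \<longleftrightarrow>
     \<not> (x < u \<and> u < y \<and> y < v) \<and> \<not> (u < x \<and> x < v \<and> v < y)"

text \<open>
  Removes from the first list every entry that occurs at the same position of the second list.
\<close>

fun remove_common :: "'a list \<Rightarrow> 'a list \<Rightarrow> 'a list" where
  "remove_common (x # xs) (y # ys) =
     (if x = y then remove_common xs ys else x # remove_common xs ys)"
| "remove_common xs [] = xs"
| "remove_common [] ys = []"

text \<open>
  The lists are the increasing enumerations of I' and J', with indices starting at 0.
\<close>

definition non_crossing_lists :: "nat list \<Rightarrow> nat list \<Rightarrow> bool" where
  "non_crossing_lists is js \<longleftrightarrow>
     (\<forall>s. s + 1 < length is \<longrightarrow>
        non_crossing_pairs (is ! s) (is ! (s + 1)) (js ! s) (js ! (s + 1))) \<and>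
     (0 < length is \<and> length is < length js \<longrightarrow>
        non_crossing_pairs (is ! (length is - 1)) \<infinity> (js ! (length is - 1)) (js ! length is))"

definition non_crossing_ordered :: "nat set \<Rightarrow> nat set \<Rightarrow> bool" where
  "non_crossing_ordered I J \<longleftrightarrow>
     (let is = sorted_list_of_set I; js = sorted_list_of_set J
      in non_crossing_lists (remove_common is js) (remove_common js is))"

definition non_crossing :: "nat set \<Rightarrow> nat set \<Rightarrow> bool" where
  "non_crossing I J \<longleftrightarrow>
     (if card I \<le> card J then non_crossing_ordered I J else non_crossing_ordered J I)"

definition nc_complex :: "nat \<Rightarrow> point set \<Rightarrow> nat set set set" where
  "nc_complex m L = {F. F \<subseteq> path_sets m L \<and> pairwise non_crossing F}"


subsection \<open>Gelfand-Tsetlin patterns\<close>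

text \<open>
  A cell is named by its southwest corner: (x, y) is the square from x to x + 1
  horizontally and from y to y + 1 vertically.
\<close>

definition cells :: "point set \<Rightarrow> point set" where
  "cells L = {(x, y). (x, y + 1) \<in> nodes L \<or> (x + 1, y) \<in> nodes L}"

definition cell_corners :: "point \<Rightarrow> point set" where
  "cell_corners = (\<lambda>(x, y). {(x, y), (x + 1, y), (x, y + 1), (x + 1, y + 1)})"

definition cell_edges :: "point \<Rightarrow> point set set" where
  "cell_edges = (\<lambda>(x, y).
     {{(x, y), (x + 1, y)}, {(x, y + 1), (x + 1, y + 1)},
      {(x, y), (x, y + 1)}, {(x + 1, y), (x + 1, y + 1)}})"

definition external_cells :: "point set \<Rightarrow> point set" where
  "external_cells L = {c \<in> cells L. \<not> cell_corners c \<subseteq> nodes L}"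

definition connected_cells :: "point set \<Rightarrow> point \<Rightarrow> point \<Rightarrow> bool" where
  "connected_cells L c d \<longleftrightarrow>
     c \<in> external_cells L \<and> d \<in> external_cells L \<and>
     (\<exists>e \<in> cell_edges c \<inter> cell_edges d. e \<notin> edges L)"

text \<open>
  A filling of the cells of L is a function on all of the grid that vanishes off the cells
  of L, so that equality of patterns is equality of functions.  The cells of L in a given
  row or column are consecutive, hence comparing arbitrary cells of a row or column is the
  same as comparing neighbours.
\<close>

definition GT :: "point set \<Rightarrow> (point \<Rightarrow> real) set" where
  "GT L = {T.
     (\<forall>c. c \<notin> cells L \<longrightarrow> T c = 0) \<and>
     (\<forall>c \<in> cells L. 0 \<le> T c) \<and>
     (\<forall>x x' y. (x, y) \<in> cells L \<and> (x', y) \<in> cells L \<and> x \<le> x' \<longrightarrow> T (x, y) \<le> T (x', y)) \<and>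
     (\<forall>x y y'. (x, y) \<in> cells L \<and> (x, y') \<in> cells L \<and> y' \<le> y \<longrightarrow> T (x, y) \<le> T (x, y')) \<and>
     (\<forall>c d. connected_cells L c d \<longrightarrow> T c = T d) \<and>
     (\<forall>y. (-1, y) \<in> external_cells L \<longrightarrow> T (-1, y) = 0)}"

text \<open>
  A cell lies southeast of a path if its northwest corner is weakly southeast of some node
  of the path, and northwest of it if its southeast corner is weakly northwest of some node.
  For a path of length m exactly one of the two holds for each cell of L
  (lemma northwest_iff_not_southeast).
\<close>

definition southeast_of :: "point set \<Rightarrow> point \<Rightarrow> bool" where
  "southeast_of p = (\<lambda>(x, y). \<exists>(u, v) \<in> p. u \<le> x \<and> y + 1 \<le> v)"

definition northwest_of :: "point set \<Rightarrow> point \<Rightarrow> bool" where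
  "northwest_of p = (\<lambda>(x, y). \<exists>(u, v) \<in> p. x + 1 \<le> u \<and> v \<le> y)"

definition path_pattern :: "point set \<Rightarrow> point set \<Rightarrow> point \<Rightarrow> real" where
  "path_pattern L p c = (if c \<in> cells L \<and> southeast_of p c then 1 else 0)"

lemma path_node_Suc:
  "path_node I (Suc t) =
     (if Suc t \<in> I then (fst (path_node I t), snd (path_node I t) + 1)
      else (fst (path_node I t) + 1, snd (path_node I t)))"
proof -
  have "{1..Suc t} - I = (if Suc t \<in> I then {1..t} - I else insert (Suc t) ({1..t} - I))"
    "{1..Suc t} \<inter> I = (if Suc t \<in> I then insert (Suc t) ({1..t} \<inter> I) else {1..t} \<inter> I)"
    by (auto simp: le_Suc_eq)
  then show ?thesis by (simp add: path_node_def)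
qed

lemma path_node_sum: "fst (path_node I t) + snd (path_node I t) = int t"
proof (induction t)
  case 0
  then show ?case by (simp add: path_node_def)
next
  case (Suc t)
  then show ?case by (simp add: path_node_Suc)
qed

lemma path_node_mono:
  "s \<le> t \<Longrightarrow> fst (path_node I s) \<le> fst (path_node I t) \<and> snd (path_node I s) \<le> snd (path_node I t)"
proof (induction t rule: dec_induct)
  case base
  then show ?case by simp
next
  case (step t)
  then show ?case by (auto simp: path_node_Suc)
qed

lemma cells_diagonal:
  assumes "partial_staircase m L" "(x, y) \<in> cells L"
  obtains t where "t \<le> m" "int t = x + y + 1"
proof -
  have "0 \<le> x + y + 1 \<and> x + y + 1 \<le> int m"
    using assms unfolding partial_staircase_def staircase_sinks_def cells_def nodes_def
    by fastforce
  then show thesis using that[of "nat (x + y + 1)"] by auto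
qed

lemma southeast_iff:
  assumes "t \<le> m" "int t = x + y + 1"
  shows "southeast_of (lattice_path m I) (x, y) \<longleftrightarrow> fst (path_node I t) \<le> x"
proof
  assume "southeast_of (lattice_path m I) (x, y)"
  then obtain s where s: "s \<le> m" "fst (path_node I s) \<le> x" "y + 1 \<le> snd (path_node I s)"
    unfolding southeast_of_def lattice_path_def by (auto simp: case_prod_unfold)
  show "fst (path_node I t) \<le> x"
    using s assms path_node_mono[of s t I] path_node_mono[of t s I]
      path_node_sum[of I s] path_node_sum[of I t] by linarith
next
  assume "fst (path_node I t) \<le> x"
  then show "southeast_of (lattice_path m I) (x, y)"
    using assms path_node_sum[of I t] unfolding southeast_of_def lattice_path_def
    by (auto intro!: bexI[of _ t] split: prod.splits)
qed

lemma northwest_iff: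
  assumes "t \<le> m" "int t = x + y + 1"
  shows "northwest_of (lattice_path m I) (x, y) \<longleftrightarrow> x < fst (path_node I t)"
proof
  assume "northwest_of (lattice_path m I) (x, y)"
  then obtain s where s: "s \<le> m" "x + 1 \<le> fst (path_node I s)" "snd (path_node I s) \<le> y"
    unfolding northwest_of_def lattice_path_def by (auto simp: case_prod_unfold)
  show "x < fst (path_node I t)"
    using s assms path_node_mono[of s t I] path_node_mono[of t s I]
      path_node_sum[of I s] path_node_sum[of I t] by linarith
next
  assume "x < fst (path_node I t)"
  then show "northwest_of (lattice_path m I) (x, y)"
    using assms path_node_sum[of I t] unfolding northwest_of_def lattice_path_def
    by (auto intro!: bexI[of _ t] split: prod.splits)
qed

lemma northwest_iff_not_southeast:
  assumes "partial_staircase m L" "c \<in> cells L"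
  shows "northwest_of (lattice_path m I) c \<longleftrightarrow> \<not> southeast_of (lattice_path m I) c"
proof -
  obtain x y where c: "c = (x, y)" by force
  obtain t where "t \<le> m" "int t = x + y + 1" using cells_diagonal assms c by metis
  then show ?thesis by (simp add: c southeast_iff northwest_iff not_le)
qed

lemma southeast_eq_if_not_edge:
  assumes L: "partial_staircase m L" and p: "lattice_path m I \<subseteq> nodes L"
    and c: "(x, y) \<in> cells L"
  shows "(x + 1, y) \<in> cells L \<Longrightarrow> {(x + 1, y), (x + 1, y + 1)} \<notin> edges L \<Longrightarrow>
      southeast_of (lattice_path m I) (x, y) = southeast_of (lattice_path m I) (x + 1, y)"
    and "(x, y + 1) \<in> cells L \<Longrightarrow> {(x, y + 1), (x + 1, y + 1)} \<notin> edges L \<Longrightarrow>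
      southeast_of (lattice_path m I) (x, y) = southeast_of (lattice_path m I) (x, y + 1)"
proof -
  obtain t where t: "t \<le> m" "int t = x + y + 1" using cells_diagonal L c by metis
  have in_L: "path_node I s \<in> nodes L" if "s \<le> m" for s
    using p that by (auto simp: lattice_path_def)
  {
    assume d: "(x + 1, y) \<in> cells L" and e: "{(x + 1, y), (x + 1, y + 1)} \<notin> edges L"
    obtain t' where t': "t' \<le> m" "int t' = (x + 1) + y + 1" using cells_diagonal L d by metis
    then have Suc: "t' = Suc t" using t by linarith
    show "southeast_of (lattice_path m I) (x, y) = southeast_of (lattice_path m I) (x + 1, y)"
    proof (rule ccontr)
      assume "\<not> ?thesis"
      then have "path_node I t = (x + 1, y) \<and> path_node I t' = (x + 1, y + 1)"
        using path_node_sum[of I t] t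
        unfolding southeast_iff[OF t] southeast_iff[OF t'] Suc path_node_Suc
        by (cases "path_node I t") (auto split: if_splits)
      then have "(x + 1, y) \<in> nodes L" "(x + 1, y + 1) \<in> nodes L"
        using in_L[OF t(1)] in_L[OF t'(1)] by auto
      then show False using e unfolding edges_def by blast
    qed
  }
  {
    assume d: "(x, y + 1) \<in> cells L" and e: "{(x, y + 1), (x + 1, y + 1)} \<notin> edges L"
    obtain t' where t': "t' \<le> m" "int t' = x + (y + 1) + 1" using cells_diagonal L d by metis
    then have Suc: "t' = Suc t" using t by linarith
    show "southeast_of (lattice_path m I) (x, y) = southeast_of (lattice_path m I) (x, y + 1)"
    proof (rule ccontr)
      assume "\<not> ?thesis"
      then have "path_node I t = (x, y + 1) \<and> path_node I t' = (x + 1, y + 1)"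
        using path_node_sum[of I t] t
        unfolding southeast_iff[OF t] southeast_iff[OF t'] Suc path_node_Suc
        by (cases "path_node I t") (auto split: if_splits)
      then have "(x, y + 1) \<in> nodes L" "(x + 1, y + 1) \<in> nodes L"
        using in_L[OF t(1)] in_L[OF t'(1)] by auto
      then show False using e unfolding edges_def by blast
    qed
  }
qed

lemma shared_edge_cases:
  assumes "e \<in> cell_edges (x, y)" "e \<in> cell_edges (x', y')"
  shows "(x' = x \<and> y' = y) \<or>
    (x' = x + 1 \<and> y' = y \<and> e = {(x + 1, y), (x + 1, y + 1)}) \<or>
    (x = x' + 1 \<and> y' = y \<and> e = {(x' + 1, y), (x' + 1, y + 1)}) \<or>
    (x' = x \<and> y' = y + 1 \<and> e = {(x, y + 1), (x + 1, y + 1)}) \<or>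
    (x' = x \<and> y = y' + 1 \<and> e = {(x, y' + 1), (x + 1, y' + 1)})"
proof -
  define h where "h a b = {(a, b), (a + 1, b)}" for a b :: int
  define v where "v a b = {(a, b), (a, b + 1)}" for a b :: int
  have h: "h a b = h a' b' \<longleftrightarrow> a = a' \<and> b = b'" for a b a' b'
    unfolding h_def doubleton_eq_iff prod.inject by linarith
  have v: "v a b = v a' b' \<longleftrightarrow> a = a' \<and> b = b'" for a b a' b'
    unfolding v_def doubleton_eq_iff prod.inject by linarith
  have hv: "h a b \<noteq> v a' b'" for a b a' b'
    unfolding h_def v_def doubleton_eq_iff prod.inject by linarith
  have cell: "cell_edges (a, b) = {h a b, h a (b + 1), v a b, v (a + 1) b}" for a b
    by (simp add: cell_edges_def h_def v_def)
  show ?thesis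
    using assms unfolding cell insert_iff empty_iff h_def[symmetric] v_def[symmetric]
    by (elim disjE FalseE) (simp_all add: h v hv hv[symmetric])
qed

lemma southeast_eq_if_connected:
  assumes L: "partial_staircase m L" and p: "lattice_path m I \<subseteq> nodes L"
    and "connected_cells L c d"
  shows "southeast_of (lattice_path m I) c = southeast_of (lattice_path m I) d"
proof -
  obtain x y x' y' where c: "c = (x, y)" and d: "d = (x', y')" by force
  have cells: "(x, y) \<in> cells L" "(x', y') \<in> cells L"
    using assms(3) c d by (auto simp: connected_cells_def external_cells_def)
  obtain e where e: "e \<in> cell_edges (x, y)" "e \<in> cell_edges (x', y')" "e \<notin> edges L"
    using assms(3) c d by (auto simp: connected_cells_def)
  show ?thesis
    using shared_edge_cases[OF e(1,2)]
    by (elim disjE conjE)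
      (use e(3) cells southeast_eq_if_not_edge[OF L p] in \<open>simp_all add: c d\<close>)
qed

lemma path_pattern_in_GT:
  assumes "partial_staircase m L" "I \<in> path_sets m L"
  shows "path_pattern L (lattice_path m I) \<in> GT L"
proof -
  have "southeast_of (lattice_path m I) c = southeast_of (lattice_path m I) d"
    if "connected_cells L c d" for c d
    using southeast_eq_if_connected assms that by (auto simp: path_sets_def)
  moreover have "c \<in> cells L \<and> d \<in> cells L" if "connected_cells L c d" for c d
    using that by (simp add: connected_cells_def external_cells_def)
  moreover have "\<not> southeast_of (lattice_path m I) (-1, y)" for y
    by (auto simp: southeast_of_def lattice_path_def path_node_def)
  moreover have "southeast_of (lattice_path m I) (x', y')"
    if se: "southeast_of (lattice_path m I) (x, y)" and le: "x \<le> x'" "y' \<le> y" for x y x' y'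
  proof -
    obtain q where "q \<in> lattice_path m I" "fst q \<le> x" "y + 1 \<le> snd q"
      using se unfolding southeast_of_def by auto
    then show ?thesis
      using le unfolding southeast_of_def by (auto simp: case_prod_unfold intro!: bexI[of _ q])
  qed
  ultimately show ?thesis
    unfolding GT_def path_pattern_def by auto
qed

end

theory Submission
  imports Defs "HOL-Library.List_Lexorder"
begin

text \<open>
  A set I is read as the increasing sequence of its elements.  The cell at (x, y) lies southeast
  of p(I) iff the (y + 1)-st element of I is at most x + y + 1, so a pattern T records, for every
  k, the distribution of the k-th element under the weights on the sets, and the conditions on T
  say that these distributions are stochastically increasing in k and that sequences end only at
  selected sinks.  The weights on prefixes of length k + 1 are a coupling of the weights on
  prefixes of length k with the distribution of the next element.  Order the prefixes by their last
  difference: two sets are non-crossing iff in every step the larger prefix either takes a smaller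
  or equal next element, or finds the element taken by the smaller prefix not above its own last
  element.  Exactly one coupling has this property, the greedy one in which the prefixes, from the
  largest downwards, take the smallest available elements.
\<close>


subsection \<open>Nested couplings\<close>

text \<open>\<open>\<gamma> p b\<close> is the weight of the prefix \<open>p\<close> extended by
  \<open>b\<close>, and \<open>h p\<close> the last element of \<open>p\<close>. The last clause is
  the non-crossing condition for one step.\<close>

definition nested_coupling :: "'a::linorder set \<Rightarrow> nat set \<Rightarrow> ('a \<Rightarrow> nat) \<Rightarrow> ('a \<Rightarrow> nat \<Rightarrow> real) \<Rightarrow> bool" where
  "nested_coupling P B h \<gamma> \<longleftrightarrow>
     (\<forall>p\<in>P. \<forall>b\<in>B. 0 \<le> \<gamma> p b \<and> (0 < \<gamma> p b \<longrightarrow> h p < b)) \<and>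
     (\<forall>p\<in>P. \<forall>q\<in>P. \<forall>a\<in>B. \<forall>b\<in>B. p < q \<longrightarrow> 0 < \<gamma> p a \<longrightarrow> 0 < \<gamma> q b \<longrightarrow> b \<le> a \<or> a \<le> h q)"

text \<open>Exchange argument: a deficit of \<open>\<gamma>\<close> at the first difference
  \<open>(q, b)\<close> forces, by the row sum, a surplus at some \<open>b' > b\<close> in row
  \<open>q\<close> and, by the column sum, one at some \<open>p < q\<close> in column
  \<open>b\<close>. Then \<open>p\<close> takes \<open>b\<close> and \<open>q\<close> takes
  \<open>b'\<close> with \<open>h q < b < b'\<close>, against nesting.\<close>

lemma nested_coupling_first_difference:
  assumes fin: "finite P" "finite B"
    and \<gamma>: "nested_coupling P B h \<gamma>" and \<gamma>': "nested_coupling P B h \<gamma>'"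
    and rows: "\<And>p. p \<in> P \<Longrightarrow> sum (\<gamma> p) B = sum (\<gamma>' p) B"
    and cols: "\<And>b. b \<in> B \<Longrightarrow> (\<Sum>p\<in>P. \<gamma> p b) = (\<Sum>p\<in>P. \<gamma>' p b)"
    and q: "q \<in> P" and above: "\<And>p v. p \<in> P \<Longrightarrow> q < p \<Longrightarrow> v \<in> B \<Longrightarrow> \<gamma> p v = \<gamma>' p v"
    and b: "b \<in> B" and below: "\<And>v. v \<in> B \<Longrightarrow> v < b \<Longrightarrow> \<gamma> q v = \<gamma>' q v"
  shows "\<gamma>' q b \<le> \<gamma> q b"
proof (rule ccontr)
  assume "\<not> ?thesis"
  then have less: "\<gamma> q b < \<gamma>' q b" by simp
  have "\<exists>b'\<in>B. \<gamma>' q b' < \<gamma> q b'"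
  proof (rule ccontr)
    assume "\<not> ?thesis"
    then have "sum (\<gamma> q) B < sum (\<gamma>' q) B"
      using less b fin by (intro sum_strict_mono_ex1) (auto simp: not_less)
    then show False using rows q by simp
  qed
  then obtain b' where b': "b' \<in> B" "\<gamma>' q b' < \<gamma> q b'" by blast
  have "\<exists>p\<in>P. \<gamma>' p b < \<gamma> p b"
  proof (rule ccontr)
    assume "\<not> ?thesis"
    then have "(\<Sum>p\<in>P. \<gamma> p b) < (\<Sum>p\<in>P. \<gamma>' p b)"
      using less q fin by (intro sum_strict_mono_ex1) (auto simp: not_less)
    then show False using cols b by simp
  qed
  then obtain p where p: "p \<in> P" "\<gamma>' p b < \<gamma> p b" by blast
  have "p < q" using above[of p b] p b less by (cases p q rule: linorder_cases) auto
  moreover have "b < b'" using below[of b'] b' less by (cases b b' rule: linorder_cases) auto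
  moreover have "0 < \<gamma> p b" "0 < \<gamma> q b'"
    using p b b' q \<gamma>' unfolding nested_coupling_def by (meson le_less_trans)+
  \<comment> \<open>\<open>\<gamma>' q b\<close> is positive, so the support condition of
    \<open>\<gamma>'\<close> applies.\<close>
  moreover have "h q < b"
    using less q b \<gamma> \<gamma>' unfolding nested_coupling_def by (meson le_less_trans)
  ultimately show False
    using \<gamma> p(1) q b b'(1) unfolding nested_coupling_def by (meson not_le)
qed

text \<open>Scanning prefixes downwards and values upwards, as the greedy coupling does, the first
  disagreement is excluded by the exchange argument in both directions.\<close>

lemma nested_coupling_unique:
  assumes fin: "finite P" "finite B"
    and \<gamma>: "nested_coupling P B h \<gamma>" and \<gamma>': "nested_coupling P B h \<gamma>'"
    and rows: "\<And>p. p \<in> P \<Longrightarrow> sum (\<gamma> p) B = sum (\<gamma>' p) B"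
    and cols: "\<And>b. b \<in> B \<Longrightarrow> (\<Sum>p\<in>P. \<gamma> p b) = (\<Sum>p\<in>P. \<gamma>' p b)"
    and "p \<in> P" "b \<in> B"
  shows "\<gamma> p b = \<gamma>' p b"
proof (rule ccontr)
  assume ne: "\<gamma> p b \<noteq> \<gamma>' p b"
  define Q where "Q = {p \<in> P. \<exists>b\<in>B. \<gamma> p b \<noteq> \<gamma>' p b}"
  have Q: "finite Q" "Q \<noteq> {}" using fin ne assms(7,8) by (auto simp: Q_def)
  define q where "q = Max Q"
  have q: "q \<in> P" "\<exists>b\<in>B. \<gamma> q b \<noteq> \<gamma>' q b"
    using Max_in[OF Q] by (auto simp: Q_def q_def)
  have above: "\<gamma> p v = \<gamma>' p v" if "p \<in> P" "q < p" "v \<in> B" for p v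
  proof (rule ccontr)
    assume "\<not> ?thesis"
    then have "p \<le> q" using that Q unfolding q_def by (intro Max_ge) (auto simp: Q_def)
    then show False using that by simp
  qed
  define C where "C = {b \<in> B. \<gamma> q b \<noteq> \<gamma>' q b}"
  have C: "finite C" "C \<noteq> {}" using fin q by (auto simp: C_def)
  define d where "d = Min C"
  have d: "d \<in> B" "\<gamma> q d \<noteq> \<gamma>' q d" using Min_in[OF C] by (auto simp: C_def d_def)
  have below: "\<gamma> q v = \<gamma>' q v" if "v \<in> B" "v < d" for v
  proof (rule ccontr)
    assume "\<not> ?thesis"
    then have "d \<le> v" using that C unfolding d_def by (intro Min_le) (auto simp: C_def)
    then show False using that by simp
  qed
  have "\<gamma>' q d \<le> \<gamma> q d"
    by (rule nested_coupling_first_difference[OF fin \<gamma> \<gamma>' rows cols q(1) above d(1) below])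
  moreover have "\<gamma> q d \<le> \<gamma>' q d"
    by (rule nested_coupling_first_difference[OF fin \<gamma>' \<gamma> rows[symmetric] cols[symmetric] q(1)
        above[symmetric] d(1) below[symmetric]])
  ultimately show False using d by simp
qed

text \<open>The last assumption is a supply condition: values up to \<open>t\<close> only fit on
  prefixes with head below \<open>t\<close>. The largest prefix is served first, and the remainder
  again satisfies all assumptions on the other prefixes.\<close>

lemma nested_coupling_exists:
  fixes \<alpha> :: "'a::linorder \<Rightarrow> real" and \<beta> :: "nat \<Rightarrow> real"
  assumes "finite P"
    and "\<And>p. p \<in> P \<Longrightarrow> 0 \<le> \<alpha> p" and "\<And>b. 0 \<le> \<beta> b"
    and "\<And>p q. p \<in> P \<Longrightarrow> q \<in> P \<Longrightarrow> p < q \<Longrightarrow> h p \<le> h q"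
    and "\<And>p. p \<in> P \<Longrightarrow> h p \<le> M"
    and "sum \<alpha> P = sum \<beta> {1..M}"
    and "\<And>t. t \<le> M \<Longrightarrow> sum \<beta> {1..t} \<le> sum \<alpha> {p\<in>P. h p < t}"
  shows "\<exists>\<gamma>. nested_coupling P {1..M} h \<gamma> \<and> (\<forall>p\<in>P. sum (\<gamma> p) {1..M} = \<alpha> p) \<and>
    (\<forall>b\<in>{1..M}. (\<Sum>p\<in>P. \<gamma> p b) = \<beta> b)"
  using assms
proof (induction P arbitrary: \<beta> rule: finite_linorder_max_induct)
  case empty
  have "\<beta> b = 0" if "b \<in> {1..M}" for b
    using empty that by (simp add: sum_nonneg_eq_0_iff)
  then show ?case by (simp add: nested_coupling_def)
next
  case (insert q P)
  note \<alpha> = insert.prems(1) and \<beta> = insert.prems(2) and h = insert.prems(3,4)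
    and total = insert.prems(5) and dom = insert.prems(6)
  have "q \<notin> P" using insert.hyps by auto
  define a where "a = \<alpha> q"
  have "0 \<le> a" using \<alpha> by (simp add: a_def)
  define B where "B t = sum \<beta> {h q<..t}" for t
  \<comment> \<open>The largest prefix q fills up with the smallest values above its head.\<close>
  define g where "g v = (if h q < v then min a (B v) - min a (B (v - 1)) else 0)" for v
  have B_step: "B v = B (v - 1) + \<beta> v" if "h q < v" for v
  proof -
    have "{h q<..v} = insert v {h q<..v - 1}" using that by auto
    then show ?thesis unfolding B_def using that by simp
  qed
  have B_mono: "B s \<le> B t" if "s \<le> t" for s t
    unfolding B_def using that \<beta> by (intro sum_mono2) auto
  have B0: "B t = 0" if "t \<le> h q" for t using that by (simp add: B_def)
  have g_nonneg: "0 \<le> g v" and g_le: "g v \<le> \<beta> v" for v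
    using B_step[of v] \<beta>[of v] by (auto simp: g_def)
  have g_pos: "h q < v" if "0 < g v" for v using that by (simp add: g_def split: if_splits)
  have g_sum: "sum g {1..t} = min a (B t)" for t
  proof (induction t)
    case 0 then show ?case using B0[of 0] \<open>0 \<le> a\<close> by simp
  next
    case (Suc t)
    then show ?case using B0[of t] B0[of "Suc t"] \<open>0 \<le> a\<close> by (auto simp: g_def)
  qed
  have h_le: "h p \<le> h q" if "p \<in> P" for p
    using h(1)[of p q] insert.hyps(2) that by simp
  have split: "{p \<in> insert q P. h p < t} = (if h q < t then insert q P else {p\<in>P. h p < t})" for t
    using h_le by (auto intro: le_less_trans)
  \<comment> \<open>By the supply condition at \<open>t = h q\<close>, the values up to
    \<open>h q\<close> weigh at most \<open>sum \<alpha> P\<close>, which leaves at least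
    \<open>\<alpha> q\<close> above the head of \<open>q\<close>.\<close>
  have "a \<le> B M"
  proof -
    have "h q \<le> M" using h by simp
    have "{1..M} = {1..h q} \<union> {h q<..M}" using \<open>h q \<le> M\<close> by auto
    then have "sum \<beta> {1..M} = sum \<beta> {1..h q} + B M"
      unfolding B_def by (simp only:) (intro sum.union_disjoint; auto)
    moreover have "sum \<beta> {1..h q} \<le> sum \<alpha> {p\<in>P. h p < h q}"
      using dom[OF \<open>h q \<le> M\<close>] unfolding split by simp
    moreover have "sum \<alpha> {p\<in>P. h p < h q} \<le> sum \<alpha> P"
      using \<alpha> insert.hyps by (intro sum_mono2) auto
    ultimately show ?thesis
      using total \<open>q \<notin> P\<close> insert.hyps(1) by (simp add: a_def)
  qed
  have g_total: "sum g {1..M} = a" unfolding g_sum using \<open>a \<le> B M\<close> by simp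
  have total': "sum \<alpha> P = (\<Sum>b=1..M. \<beta> b - g b)"
    using total g_total \<open>q \<notin> P\<close> insert.hyps(1) by (simp add: sum_subtractf a_def)
  \<comment> \<open>Up to \<open>h q\<close> nothing has been taken; beyond it all of
    \<open>P\<close> is admissible and the bound is the total.\<close>
  have dom': "(\<Sum>b=1..t. \<beta> b - g b) \<le> sum \<alpha> {p\<in>P. h p < t}" if "t \<le> M" for t
  proof (cases "h q < t")
    case True
    then have "{p\<in>P. h p < t} = P" using h_le by (auto intro: le_less_trans)
    moreover have "(\<Sum>b=1..t. \<beta> b - g b) \<le> (\<Sum>b=1..M. \<beta> b - g b)"
      using that g_le by (intro sum_mono2) auto
    ultimately show ?thesis using total' by simp
  next
    case False
    then have "(\<Sum>b=1..t. \<beta> b - g b) = sum \<beta> {1..t}"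
      by (intro sum.cong) (auto simp: g_def)
    then show ?thesis using dom[OF that] False unfolding split by simp
  qed
  obtain \<gamma> where \<gamma>: "nested_coupling P {1..M} h \<gamma>" "\<And>p. p \<in> P \<Longrightarrow> sum (\<gamma> p) {1..M} = \<alpha> p"
    "\<And>b. b \<in> {1..M} \<Longrightarrow> (\<Sum>p\<in>P. \<gamma> p b) = \<beta> b - g b"
    using insert.IH[of "\<lambda>b. \<beta> b - g b"] \<alpha> h g_le total' dom' by auto
  define \<delta> where "\<delta> p = (if p = q then g else \<gamma> p)" for p
  have \<delta>_P: "\<delta> p = \<gamma> p" if "p \<in> P" for p using that \<open>q \<notin> P\<close> by (auto simp: \<delta>_def)
  have \<delta>_q: "\<delta> q = g" by (simp add: \<delta>_def)
  \<comment> \<open>If \<open>q\<close> takes \<open>b > v > h q\<close>, the greedy filling has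
    used up the column \<open>v\<close>, so none of it is left for \<open>P\<close>.\<close>
  have cross: "b \<le> v \<or> v \<le> h q"
    if "p \<in> P" "v \<in> {1..M}" "0 < \<gamma> p v" "0 < g b" for p v b
  proof (rule ccontr)
    assume "\<not> ?thesis"
    then have less: "h q < v" "v < b" by auto
    have "\<gamma> p v \<le> (\<Sum>p\<in>P. \<gamma> p v)"
      using that \<gamma>(1) insert.hyps(1) by (intro member_le_sum) (auto simp: nested_coupling_def)
    then have strict: "g v < \<beta> v" using \<gamma>(3)[of v] that by simp
    have "B (b - 1) < a" using that(4) B_mono[of "b - 1" b] by (auto simp: g_def split: if_splits)
    moreover have "B v \<le> B (b - 1)" using less by (intro B_mono) simp
    ultimately have "B v < a" by simp
    then have "g v = \<beta> v"
      using B_step[OF less(1)] B_mono[of "v - 1" v] less by (simp add: g_def)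
    then show False using strict by simp
  qed
  have "nested_coupling (insert q P) {1..M} h \<delta>"
    unfolding nested_coupling_def
  proof (intro conjI ballI impI)
    fix p b assume "p \<in> insert q P" "b \<in> {1..M}"
    then show "0 \<le> \<delta> p b" using \<gamma>(1) g_nonneg \<delta>_P \<delta>_q by (auto simp: nested_coupling_def)
  next
    fix p b assume "p \<in> insert q P" "b \<in> {1..M}" "0 < \<delta> p b"
    then show "h p < b"
      using \<gamma>(1) g_pos[of b] by (auto simp: nested_coupling_def \<delta>_def split: if_splits)
  next
    fix p p' v b
    assume *: "p \<in> insert q P" "p' \<in> insert q P" "v \<in> {1..M}" "b \<in> {1..M}" "p < p'"
      "0 < \<delta> p v" "0 < \<delta> p' b"
    have "p \<in> P" using *(1,2,5) insert.hyps(2) by (metis insertE less_asym less_irrefl)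
    show "b \<le> v \<or> v \<le> h p'"
    proof (cases "p' = q")
      case True
      then show ?thesis using cross[of p v b] * \<open>p \<in> P\<close> \<delta>_P \<delta>_q by auto
    next
      case False
      then show ?thesis using * \<open>p \<in> P\<close> \<gamma>(1) \<delta>_P unfolding nested_coupling_def by (metis insertE)
    qed
  qed
  moreover have "\<forall>p\<in>insert q P. sum (\<delta> p) {1..M} = \<alpha> p"
    using \<gamma>(2) g_total \<delta>_P \<delta>_q by (auto simp: a_def)
  moreover have "\<forall>b\<in>{1..M}. (\<Sum>p\<in>insert q P. \<delta> p b) = \<beta> b"
    using \<gamma>(3) \<delta>_P \<delta>_q \<open>q \<notin> P\<close> insert.hyps(1) by simp
  ultimately show ?case by blast
qed


subsection \<open>Non-crossing weights on sequences\<close>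

text \<open>
  Prefixes are stored in reverse, so that the lexicographic order of lists compares them at their
  last difference and the head is the most recent element.
\<close>

definition seqs :: "nat \<Rightarrow> nat \<Rightarrow> nat list set" where
  "seqs M N = {x. set x \<subseteq> {1..M} \<and> length x = N}"

text \<open>The default 0 lies below all entries, so the empty prefix leaves the first element
  free.\<close>

definition head :: "nat list \<Rightarrow> nat" where
  "head x = (case x of [] \<Rightarrow> 0 | a # _ \<Rightarrow> a)"

definition nested_step :: "nat list \<Rightarrow> nat list \<Rightarrow> nat \<Rightarrow> nat \<Rightarrow> bool" where
  "nested_step p q a b \<longleftrightarrow>
     (p < q \<longrightarrow> b \<le> a \<or> a \<le> head q) \<and> (q < p \<longrightarrow> a \<le> b \<or> b \<le> head p)"

fun nested :: "nat list \<Rightarrow> nat list \<Rightarrow> bool" where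
  "nested (a # p) (b # q) \<longleftrightarrow> nested p q \<and> nested_step p q a b"
| "nested _ _ \<longleftrightarrow> True"

definition nested_weights :: "nat \<Rightarrow> nat \<Rightarrow> (nat list \<Rightarrow> real) \<Rightarrow> bool" where
  "nested_weights M N c \<longleftrightarrow>
     (\<forall>x. 0 \<le> c x) \<and> (\<forall>x. 0 < c x \<longrightarrow> x \<in> seqs M N \<and> sorted_wrt (>) x) \<and>
     (\<forall>x y. 0 < c x \<longrightarrow> 0 < c y \<longrightarrow> nested x y)"

definition cumulative :: "nat \<Rightarrow> nat \<Rightarrow> (nat list \<Rightarrow> real) \<Rightarrow> nat \<Rightarrow> nat \<Rightarrow> real" where
  "cumulative M N c s t = (\<Sum>x\<in>seqs M N. if rev x ! s \<le> t then c x else 0)"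

definition push :: "nat \<Rightarrow> (nat list \<Rightarrow> real) \<Rightarrow> nat list \<Rightarrow> real" where
  "push M c p = (\<Sum>b=1..M. c (b # p))"

section \<open>Marginals of weights on prefixes and on the last element\<close>

lemma finite_seqs [simp]: "finite (seqs M N)"
  unfolding seqs_def by (rule finite_lists_length_eq) simp

lemma seqs_0: "seqs M 0 = {[]}"
  by (auto simp: seqs_def)

lemma sum_seqs_Suc:
  "(\<Sum>x\<in>seqs M (Suc N). f x) = (\<Sum>p\<in>seqs M N. \<Sum>b=1..M. f (b # p))"
proof -
  have "(\<Sum>x\<in>seqs M (Suc N). f x) = (\<Sum>(p, b)\<in>seqs M N \<times> {1..M}. f (b # p))"
    by (rule sum.reindex_bij_witness[where i = "\<lambda>(p, b). b # p" and j = "\<lambda>x. (tl x, hd x)"])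
      (auto simp: seqs_def length_Suc_conv)
  then show ?thesis by (simp add: sum.cartesian_product)
qed

lemma total_push: "sum c (seqs M (Suc N)) = sum (push M c) (seqs M N)"
  by (simp add: sum_seqs_Suc push_def)

lemma cumulative_push:
  assumes "s < N"
  shows "cumulative M (Suc N) c s t = cumulative M N (push M c) s t"
proof -
  have "rev (b # p) ! s = rev p ! s" if "p \<in> seqs M N" for b p
    using assms that by (simp add: seqs_def nth_append)
  then show ?thesis
    by (auto simp: cumulative_def sum_seqs_Suc push_def intro!: sum.cong)
qed

lemma cumulative_last:
  "cumulative M (Suc N) c N t = (\<Sum>b=1..M. if b \<le> t then \<Sum>p\<in>seqs M N. c (b # p) else 0)"
proof -
  have "rev (b # p) ! N = b" if "p \<in> seqs M N" for b p
    using that by (simp add: seqs_def nth_append)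
  then have "cumulative M (Suc N) c N t = (\<Sum>p\<in>seqs M N. \<Sum>b=1..M. if b \<le> t then c (b # p) else 0)"
    by (simp add: cumulative_def sum_seqs_Suc)
  also have "\<dots> = (\<Sum>b=1..M. \<Sum>p\<in>seqs M N. if b \<le> t then c (b # p) else 0)"
    by (rule sum.swap)
  finally show ?thesis by (simp add: if_distrib cong: if_cong) (auto intro!: sum.cong)
qed

lemma nested_weights_push:
  assumes "nested_weights M (Suc N) c"
  shows "nested_weights M N (push M c)"
proof -
  have nonneg: "0 \<le> c x" for x using assms by (simp add: nested_weights_def)
  have ex: "\<exists>b. 0 < c (b # p)" if "0 < push M c p" for p
  proof (rule ccontr)
    assume "\<not> ?thesis"
    then have "c (b # p) = 0" for b using nonneg[of "b # p"] by (meson not_le order_antisym)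
    then show False using that by (simp add: push_def)
  qed
  show ?thesis
    unfolding nested_weights_def
  proof (intro conjI allI impI)
    show "0 \<le> push M c x" for x using nonneg by (simp add: push_def sum_nonneg)
    show "x \<in> seqs M N" "sorted_wrt (>) x" if "0 < push M c x" for x
      using ex[OF that] assms unfolding nested_weights_def seqs_def by fastforce+
    show "nested x y" if "0 < push M c x" "0 < push M c y" for x y
      using ex[OF that(1)] ex[OF that(2)] assms unfolding nested_weights_def
      by (metis nested.simps(1))
  qed
qed

lemma nested_coupling_of_weights:
  assumes "nested_weights M (Suc N) c"
  shows "nested_coupling (seqs M N) {1..M} head (\<lambda>p b. c (b # p))"
  unfolding nested_coupling_def
proof (intro conjI ballI impI)
  fix p b
  show "0 \<le> c (b # p)" using assms by (simp add: nested_weights_def)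
  assume "0 < c (b # p)" and b: "b \<in> {1..M}"
  then have "sorted_wrt (>) (b # p)" using assms unfolding nested_weights_def by blast
  then show "head p < b" using b by (cases p) (auto simp: head_def)
next
  fix p q a b
  assume "p < q" "0 < c (a # p)" "0 < c (b # q)"
  then have "nested (a # p) (b # q)" using assms unfolding nested_weights_def by blast
  then show "b \<le> a \<or> a \<le> head q" using \<open>p < q\<close> by (simp add: nested_step_def)
qed

text \<open>Induction on the length: the marginals on prefixes agree by the induction hypothesis,
  those of the last element are read off \<open>cumulative\<close>, and a nested coupling is
  determined by its two marginals.\<close>

lemma nested_weights_unique:
  assumes "nested_weights M N c" "nested_weights M N c'"
    and "sum c (seqs M N) = sum c' (seqs M N)"
    and "\<And>s t. s < N \<Longrightarrow> cumulative M N c s t = cumulative M N c' s t"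
  shows "c = c'"
  using assms
proof (induction N arbitrary: c c')
  case 0
  have "c x = c' x" for x
  proof (cases "x = []")
    case True
    then show ?thesis using "0.prems"(3) by (simp add: seqs_0)
  next
    case False
    then have "\<not> 0 < c x" "\<not> 0 < c' x"
      using "0.prems"(1,2) by (auto simp: nested_weights_def seqs_0)
    then show ?thesis using "0.prems"(1,2) by (metis nested_weights_def order_antisym not_le)
  qed
  then show ?case by blast
next
  case (Suc N)
  note c = Suc.prems(1) and c' = Suc.prems(2)
  have push: "push M c = push M c'"
  proof (rule Suc.IH)
    show "sum (push M c) (seqs M N) = sum (push M c') (seqs M N)"
      using Suc.prems(3) by (simp add: total_push)
    show "cumulative M N (push M c) s t = cumulative M N (push M c') s t" if "s < N" for s t
      using Suc.prems(4)[of s t] that by (simp add: cumulative_push)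
  qed (use c c' nested_weights_push in auto)
  \<comment> \<open>A distribution function determines its point masses; \<open>b - 1\<close> is a
    true predecessor because \<open>1 \<le> b\<close>.\<close>
  have last: "(\<Sum>p\<in>seqs M N. w (b # p)) = cumulative M (Suc N) w N b - cumulative M (Suc N) w N (b - 1)"
    if b: "b \<in> {1..M}" for b w
  proof -
    have "cumulative M (Suc N) w N b - cumulative M (Suc N) w N (b - 1) =
        (\<Sum>v=1..M. if v = b then \<Sum>p\<in>seqs M N. w (b # p) else 0)"
      unfolding cumulative_last sum_subtractf[symmetric] using b by (intro sum.cong) auto
    then show ?thesis using b by simp
  qed
  have coupled: "c (b # p) = c' (b # p)" if "p \<in> seqs M N" "b \<in> {1..M}" for p b
  proof (rule nested_coupling_unique[where P = "seqs M N" and B = "{1..M}" and h = head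
        and \<gamma> = "\<lambda>p b. c (b # p)" and \<gamma>' = "\<lambda>p b. c' (b # p)"])
    show "(\<Sum>b=1..M. c (b # p)) = (\<Sum>b=1..M. c' (b # p))" for p
      using push by (metis push_def)
    show "(\<Sum>p\<in>seqs M N. c (b # p)) = (\<Sum>p\<in>seqs M N. c' (b # p))" if "b \<in> {1..M}" for b
      using last[OF that] Suc.prems(4) by simp
  qed (use that c c' nested_coupling_of_weights in auto)
  have "c x = c' x" for x
  proof (cases "x \<in> seqs M (Suc N)")
    case True
    then obtain b p where "x = b # p" "b \<in> {1..M}" "p \<in> seqs M N"
      by (cases x) (auto simp: seqs_def)
    then show ?thesis using coupled by simp
  next
    case False
    then have "\<not> 0 < c x" "\<not> 0 < c' x" using c c' by (auto simp: nested_weights_def)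
    then show ?thesis using c c' by (metis nested_weights_def order_antisym not_le)
  qed
  then show ?case by blast
qed

text \<open>\<open>H (Suc s) (Suc t) \<le> H s t\<close> says that each element is stochastically at
  least one larger than its predecessor. This yields the supply condition for coupling the weights
  on prefixes with the next element.\<close>

lemma nested_weights_exist:
  fixes H :: "nat \<Rightarrow> nat \<Rightarrow> real"
  assumes "0 \<le> n"
    and "\<And>s. s < N \<Longrightarrow> mono (H s)" and "\<And>s. s < N \<Longrightarrow> H s 0 = 0"
    and "\<And>s t. s < N \<Longrightarrow> M \<le> t \<Longrightarrow> H s t = n"
    and "\<And>s t. Suc s < N \<Longrightarrow> H (Suc s) (Suc t) \<le> H s t"
  shows "\<exists>c. nested_weights M N c \<and> sum c (seqs M N) = n \<and>
    (\<forall>s<N. \<forall>t. cumulative M N c s t = H s t)"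
  using assms
proof (induction N)
  case 0
  show ?case
    by (rule exI[of _ "\<lambda>x. if x = [] then n else 0"])
      (use 0 in \<open>auto simp: nested_weights_def seqs_0\<close>)
next
  case (Suc N)
  then obtain c where c: "nested_weights M N c" "sum c (seqs M N) = n"
    "\<And>s t. s < N \<Longrightarrow> cumulative M N c s t = H s t"
    by auto
  note H = Suc.prems(2-)
  have mono: "H N s \<le> H N t" if "s \<le> t" for s t using H(1)[of N] that by (simp add: monoD)
  define \<beta> where "\<beta> b = H N b - H N (b - 1)" for b
  have \<beta>_sum: "sum \<beta> {1..t} = H N t" for t
  proof (induction t)
    case 0 then show ?case using H(2)[of N] by simp
  next
    case (Suc t) then show ?case by (simp add: \<beta>_def)
  qed
  \<comment> \<open>For \<open>N > 0\<close> a head below \<open>Suc u\<close> is a previous element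
    at most \<open>u\<close>, of weight \<open>H (N - 1) u\<close>; for \<open>N = 0\<close> the
    head 0 of the empty prefix is below every positive \<open>t\<close>.\<close>
  have "H N t \<le> sum c {p\<in>seqs M N. head p < t}" if "t \<le> M" for t
  proof (cases t)
    case 0
    then show ?thesis using H(2)[of N] by simp
  next
    case t: (Suc u)
    show ?thesis
    proof (cases N)
      case 0
      then have "{p\<in>seqs M N. head p < t} = seqs M N" by (auto simp: seqs_0 head_def t)
      then show ?thesis using c(2) mono[of t "max t M"] H(3)[of N "max t M"] by simp
    next
      case (Suc k)
      have "rev p ! k = head p" if "p \<in> seqs M N" for p
        using that unfolding Suc by (cases p) (auto simp: seqs_def head_def nth_append)
      then have "sum c {p\<in>seqs M N. head p < t} = cumulative M N c k u"
        unfolding cumulative_def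
        by (simp add: sum.If_cases t less_Suc_eq_le Int_def cong: conj_cong)
      then show ?thesis using c(3)[of k u] H(4)[of k u] Suc t by simp
    qed
  qed
  moreover have "head p \<le> head q" if "p \<in> seqs M N" "q \<in> seqs M N" "p < q" for p q
    using that by (cases p; cases q) (auto simp: head_def)
  moreover have "head p \<le> M" if "p \<in> seqs M N" for p
    using that by (cases p) (auto simp: head_def seqs_def)
  moreover have "0 \<le> c p" for p using c(1) by (simp add: nested_weights_def)
  moreover have "sum c (seqs M N) = H N M" using c(2) H(3)[of N M] by simp
  moreover have "0 \<le> \<beta> b" for b using mono by (simp add: \<beta>_def)
  ultimately obtain \<gamma> where \<gamma>: "nested_coupling (seqs M N) {1..M} head \<gamma>"
    "\<And>p. p \<in> seqs M N \<Longrightarrow> sum (\<gamma> p) {1..M} = c p"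
    "\<And>b. b \<in> {1..M} \<Longrightarrow> (\<Sum>p\<in>seqs M N. \<gamma> p b) = \<beta> b"
    using nested_coupling_exists[of "seqs M N" c \<beta> head M] unfolding \<beta>_sum by auto
  define d where "d x = (case x of [] \<Rightarrow> 0 | b # p \<Rightarrow>
    if p \<in> seqs M N \<and> b \<in> {1..M} then \<gamma> p b else 0)" for x
  have d: "d (b # p) = \<gamma> p b" if "p \<in> seqs M N" "b \<in> {1..M}" for p b
    using that by (simp add: d_def)
  have push: "push M d p = c p" if "p \<in> seqs M N" for p
    using \<gamma>(2) that d unfolding push_def by (metis (no_types, lifting) sum.cong)
  have d_pos: "\<exists>b p. x = b # p \<and> p \<in> seqs M N \<and> b \<in> {1..M} \<and> 0 < \<gamma> p b \<and> 0 < c p \<and> head p < b"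
    if pos: "0 < d x" for x
  proof -
    obtain b p where x: "x = b # p" "p \<in> seqs M N" "b \<in> {1..M}" "0 < \<gamma> p b"
      using pos by (auto simp: d_def split: list.splits if_splits)
    moreover have "\<gamma> p b \<le> sum (\<gamma> p) {1..M}"
      using x \<gamma>(1) by (intro member_le_sum) (auto simp: nested_coupling_def)
    moreover have "head p < b" using x \<gamma>(1) by (auto simp: nested_coupling_def)
    ultimately show ?thesis using \<gamma>(2) by fastforce
  qed
  have "nested_weights M (Suc N) d"
    unfolding nested_weights_def
  proof (intro conjI allI impI)
    show "0 \<le> d x" for x
      using \<gamma>(1) by (auto simp: d_def nested_coupling_def split: list.splits)
  next
    fix x assume "0 < d x"
    then obtain b p where x: "x = b # p" "p \<in> seqs M N" "b \<in> {1..M}" "0 < c p" "head p < b"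
      using d_pos by blast
    then show "x \<in> seqs M (Suc N)" by (simp add: seqs_def)
    have "sorted_wrt (>) p" using x(4) c(1) by (simp add: nested_weights_def)
    then show "sorted_wrt (>) x" using x(1,5) by (cases p) (auto simp: head_def)
  next
    fix x y assume "0 < d x" "0 < d y"
    then obtain a p b q where x: "x = a # p" "p \<in> seqs M N" "a \<in> {1..M}" "0 < \<gamma> p a" "0 < c p"
      and y: "y = b # q" "q \<in> seqs M N" "b \<in> {1..M}" "0 < \<gamma> q b" "0 < c q"
      using d_pos by meson
    have "nested p q" using c(1) x(5) y(5) by (simp add: nested_weights_def)
    moreover have "nested_step p q a b"
      using \<gamma>(1) x y unfolding nested_coupling_def nested_step_def by blast
    ultimately show "nested x y" using x y by simp
  qed
  moreover have "sum d (seqs M (Suc N)) = n"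
    using c(2) push by (simp add: total_push)
  moreover have "cumulative M (Suc N) d s t = H s t" if "s < Suc N" for s t
  proof (cases "s = N")
    case True
    have "cumulative M (Suc N) d s t = (\<Sum>b=1..M. if b \<le> t then \<beta> b else 0)"
      using \<gamma>(3) d unfolding True cumulative_last by (intro sum.cong) auto
    also have "\<dots> = sum \<beta> {1..min t M}"
      by (simp add: sum.If_cases Int_def) (auto intro!: sum.cong)
    also have "\<dots> = H s t" unfolding \<beta>_sum using True H(3)[of N] by (simp add: min_def)
    finally show ?thesis .
  next
    case False
    then have "cumulative M (Suc N) d s t = cumulative M N (push M d) s t"
      using that by (simp add: cumulative_push)
    also have "\<dots> = cumulative M N c s t"
      unfolding cumulative_def by (intro sum.cong) (auto simp: push)
    finally show ?thesis using that False c(3)[of s t] by simp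
  qed
  ultimately show ?case by blast
qed


subsection \<open>Sets as padded sequences\<close>

text \<open>The argument r holds the last difference met so far.\<close>

fun nc_from :: "(nat \<times> nat) option \<Rightarrow> nat list \<Rightarrow> nat list \<Rightarrow> bool" where
  "nc_from r (x # xs) (y # ys) =
     (if x = y then nc_from r xs ys
      else (case r of None \<Rightarrow> True | Some (u, v) \<Rightarrow> non_crossing_pairs (enat u) (enat x) (enat v) (enat y)) \<and>
        nc_from (Some (x, y)) xs ys)"
| "nc_from r [] (y # ys) =
     (case r of None \<Rightarrow> True | Some (u, v) \<Rightarrow> non_crossing_pairs (enat u) \<infinity> (enat v) (enat y))"
| "nc_from r xs [] = True"

lemma non_crossing_lists_simps [simp]:
  "non_crossing_lists [] ys"
  "non_crossing_lists [u] [v]"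
  "non_crossing_lists [u] (v # y # ys) \<longleftrightarrow> non_crossing_pairs (enat u) \<infinity> (enat v) (enat y)"
  by (auto simp: non_crossing_lists_def)

lemma non_crossing_lists_Cons [simp]:
  "non_crossing_lists (u # x # xs) (v # y # ys) \<longleftrightarrow>
     non_crossing_pairs (enat u) (enat x) (enat v) (enat y) \<and> non_crossing_lists (x # xs) (y # ys)"
  by (simp add: non_crossing_lists_def all_conj_distrib less_Suc_eq_0_disj nth_Cons split: nat.splits)

text \<open>The entries deleted by \<open>remove_common\<close> are those skipped by
  \<open>nc_from\<close>, so \<open>(u, v)\<close> is always the preceding pair of surviving
  entries. By the length assumption only the second list can run over, which is where the pair with
  infinity arises.\<close>

lemma non_crossing_lists_remove_common_Cons:
  "length xs \<le> length ys \<Longrightarrow>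
    non_crossing_lists (u # remove_common xs ys) (v # remove_common ys xs) = nc_from (Some (u, v)) xs ys"
proof (induction xs arbitrary: u v ys)
  case Nil
  then show ?case by (cases ys) auto
next
  case (Cons x xs)
  then show ?case by (cases ys) auto
qed

lemma non_crossing_lists_remove_common:
  "length xs \<le> length ys \<Longrightarrow>
    non_crossing_lists (remove_common xs ys) (remove_common ys xs) = nc_from None xs ys"
proof (induction xs arbitrary: ys)
  case Nil
  then show ?case by (cases ys) auto
next
  case (Cons x xs)
  then show ?case by (cases ys) (auto simp: non_crossing_lists_remove_common_Cons)
qed

text \<open>
  A set with fewer than m elements is padded to length m, the missing entry at position i
  (counted from 0) being m + 1 + i.  These entries exceed m like the infinity in the
  non-crossing rule, and they make all sequences strictly increasing of the same length.
\<close>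

definition pad :: "nat \<Rightarrow> nat \<Rightarrow> nat list" where
  "pad m k = map (\<lambda>i. m + 1 + i) [k..<m]"

lemma pad_Suc: "k < m \<Longrightarrow> pad m k = (m + 1 + k) # pad m (Suc k)"
  by (simp add: pad_def upt_conv_Cons)

lemma nc_from_refl: "nc_from r xs xs"
  by (induction xs) auto

text \<open>Once the shorter list has run out, its previous entry \<open>u\<close> exceeds
  \<open>m\<close> while \<open>v\<close> and the entries of \<open>ys\<close> do not, so nothing
  crosses. After \<open>ys\<close> both lists carry the same padding, which depends on the position
  only.\<close>

lemma nc_from_pad_left:
  "set ys \<subseteq> {..m} \<Longrightarrow> k + length ys \<le> m \<Longrightarrow> m < u \<Longrightarrow> u < m + 1 + k \<Longrightarrow> v \<le> m \<Longrightarrow>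
    nc_from (Some (u, v)) (pad m k) (ys @ pad m (k + length ys))"
proof (induction ys arbitrary: u v k)
  case Nil
  then show ?case by (simp add: nc_from_refl)
next
  case (Cons y ys)
  then show ?case
    using Cons.IH[of "Suc k" "m + 1 + k" y] by (simp add: pad_Suc non_crossing_pairs_def)
qed

text \<open>The first padding entry met by an element acts as infinity, since elements are at most
  \<open>m\<close>; the comparisons after it hold by \<open>nc_from_pad_left\<close>.\<close>

lemma nc_from_pad:
  assumes "length xs \<le> length ys" "set xs \<subseteq> {..m}" "set ys \<subseteq> {..m}" "k + length ys \<le> m"
    and "\<And>u v. r = Some (u, v) \<Longrightarrow> u \<le> m \<and> v \<le> m"
  shows "nc_from r (xs @ pad m (k + length xs)) (ys @ pad m (k + length ys)) = nc_from r xs ys"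
  using assms
proof (induction xs arbitrary: r ys k)
  case Nil
  show ?case
  proof (cases ys)
    case Nil
    then show ?thesis by (simp add: nc_from_refl)
  next
    case (Cons y zs)
    then have "nc_from (Some (m + 1 + k, y)) (pad m (Suc k)) (zs @ pad m (Suc k + length zs))"
      using Nil.prems by (intro nc_from_pad_left) auto
    then show ?thesis
      using Nil.prems Cons by (auto simp: pad_Suc non_crossing_pairs_def split: option.splits)
  qed
next
  case (Cons x xs)
  then obtain y zs where ys: "ys = y # zs" by (cases ys) auto
  have "nc_from r' (xs @ pad m (Suc k + length xs)) (zs @ pad m (Suc k + length zs)) = nc_from r' xs zs"
    if "r' = r \<or> r' = Some (x, y)" for r'
    using Cons.prems ys that by (intro Cons.IH) auto
  then show ?case by (simp add: ys)
qed

section \<open>Nestedness and the last difference of prefixes\<close>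

fun first_difference :: "nat list \<Rightarrow> nat list \<Rightarrow> (nat \<times> nat) option" where
  "first_difference (a # p) (b # q) = (if a = b then first_difference p q else Some (a, b))"
| "first_difference _ _ = None"

lemma first_difference_None:
  "length p = length q \<Longrightarrow> first_difference p q = None \<longleftrightarrow> p = q"
  by (induction p q rule: list_induct2) auto

text \<open>For reversed prefixes this is their last difference. It decides the lexicographic order,
  and heads that differ are themselves this difference.\<close>

lemma first_difference_Some:
  assumes "length p = length q" "first_difference p q = Some (u, v)"
  shows "u \<noteq> v \<and> (p < q \<longleftrightarrow> u < v) \<and> u \<in> set p \<and> v \<in> set q \<and>
    (head p = head q \<or> head p = u \<and> head q = v)"
  using assms
  by (induction p q rule: list_induct2) (auto simp: head_def split: if_splits)

text \<open>For \<open>u < v\<close>, that is \<open>p < q\<close>, the only possible crossing is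
  \<open>u < v < x < y\<close>, while \<open>nested_step\<close> forbids
  \<open>head q < x < y\<close>. These agree: either \<open>head q = v\<close>, or the heads
  coincide and both \<open>v < x\<close> and \<open>head q < x\<close> are automatic. The case
  \<open>v < u\<close> is symmetric.\<close>

lemma nested_step_iff:
  assumes "length p = length q" "sorted_wrt (>) (x # p)" "sorted_wrt (>) (y # q)"
  shows "nested_step p q x y \<longleftrightarrow> x = y \<or>
    (case first_difference p q of None \<Rightarrow> True
     | Some (u, v) \<Rightarrow> non_crossing_pairs (enat u) (enat x) (enat v) (enat y))"
proof (cases "first_difference p q")
  case None
  then show ?thesis using first_difference_None[OF assms(1)] by (simp add: nested_step_def)
next
  case (Some r)
  then obtain u v where r: "first_difference p q = Some (u, v)" by (cases r) auto
  note * = first_difference_Some[OF assms(1) r]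
  have "u < x" "v < y" using * assms by auto
  moreover have "head p < x" "head q < y"
    using * assms by (cases p; cases q; auto simp: head_def)+
  moreover have "u \<le> head p" "v \<le> head q"
    using * assms by (cases p; cases q; auto simp: head_def)+
  moreover have "q < p \<longleftrightarrow> v < u" using * r first_difference_None[of q q] by (cases p q rule: linorder_cases) auto
  ultimately show ?thesis
    using * unfolding r nested_step_def non_crossing_pairs_def by auto
qed

text \<open>\<open>p\<close> and \<open>q\<close> are the parts already read, in reverse; their last
  difference is precisely the state carried by \<open>nc_from\<close>.\<close>

lemma nested_rev_append:
  assumes "length xs = length ys" "length p = length q"
    and "sorted_wrt (>) (rev xs @ p)" "sorted_wrt (>) (rev ys @ q)"
  shows "nested (rev xs @ p) (rev ys @ q) \<longleftrightarrow> nested p q \<and> nc_from (first_difference p q) xs ys"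
  using assms
proof (induction xs ys arbitrary: p q rule: list_induct2)
  case Nil
  then show ?case by simp
next
  case (Cons x xs y ys)
  have "nested_step p q x y \<longleftrightarrow> x = y \<or>
    (case first_difference p q of None \<Rightarrow> True
     | Some (u, v) \<Rightarrow> non_crossing_pairs (enat u) (enat x) (enat v) (enat y))"
    using Cons.prems by (intro nested_step_iff) (auto simp: sorted_wrt_append)
  then show ?case using Cons.IH[of "x # p" "y # q"] Cons.prems by auto
qed

lemma nested_sym: "nested x y = nested y x"
  by (induction x y rule: nested.induct) (auto simp: nested_step_def)

section \<open>The encoding of sets and its image\<close>

definition code :: "nat \<Rightarrow> nat set \<Rightarrow> nat list" where
  "code m I = rev (sorted_list_of_set I @ pad m (card I))"

lemma subset_range_card:
  assumes "I \<subseteq> {1..m}"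
  shows "finite I" "card I \<le> m"
  using finite_subset[OF assms] card_mono[OF _ assms] by auto

lemma length_code: "I \<subseteq> {1..m} \<Longrightarrow> length (code m I) = m"
  using subset_range_card[of I m] by (simp add: code_def pad_def)

lemma code_in_seqs: "I \<subseteq> {1..m} \<Longrightarrow> code m I \<in> seqs (2 * m) m"
  using length_code[of I m] subset_range_card[of I m]
  by (fastforce simp: seqs_def code_def pad_def)

lemma sorted_code: "I \<subseteq> {1..m} \<Longrightarrow> sorted_wrt (>) (code m I)"
  using subset_range_card[of I m]
  by (fastforce simp: code_def pad_def sorted_wrt_rev sorted_wrt_append sorted_wrt_map)

lemma non_crossing_iff_nested:
  assumes "I \<subseteq> {1..m}" "J \<subseteq> {1..m}"
  shows "non_crossing I J \<longleftrightarrow> nested (code m I) (code m J)"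
proof -
  have *: "non_crossing_ordered I J \<longleftrightarrow> nested (code m I) (code m J)"
    if IJ: "I \<subseteq> {1..m}" "J \<subseteq> {1..m}" "card I \<le> card J" for I J
  proof -
    let ?x = "sorted_list_of_set I" and ?y = "sorted_list_of_set J"
    note fin = subset_range_card[OF IJ(1)] subset_range_card[OF IJ(2)]
    have "non_crossing_ordered I J \<longleftrightarrow> nc_from None ?x ?y"
      using IJ by (simp add: non_crossing_ordered_def non_crossing_lists_remove_common)
    also have "\<dots> \<longleftrightarrow> nc_from None (?x @ pad m (0 + length ?x)) (?y @ pad m (0 + length ?y))"
      using IJ fin by (intro nc_from_pad[symmetric]) auto
    also have "\<dots> \<longleftrightarrow> nested (code m I) (code m J)"
      using nested_rev_append[of "?x @ pad m (card I)" "?y @ pad m (card J)" "[]" "[]"]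
        sorted_code[OF IJ(1)] sorted_code[OF IJ(2)] length_code[OF IJ(1)] length_code[OF IJ(2)]
      by (simp add: code_def)
    finally show ?thesis .
  qed
  show ?thesis
    using *[OF assms] *[OF assms(2,1)] by (auto simp: non_crossing_def nested_sym[of "code m J"])
qed

text \<open>The padding entry at position \<open>s\<close> is \<open>m + 1 + s\<close>, so up to
  \<open>m + s\<close> only genuine elements count, and these are at most \<open>m\<close>, whence
  \<open>min t m\<close>. Positions start at 0, so \<open>s < card\<close> asks for
  \<open>s + 1\<close> elements.\<close>

lemma code_nth_le_iff:
  assumes I: "I \<subseteq> {1..m}" and s: "s < m"
  shows "rev (code m I) ! s \<le> t \<longleftrightarrow> (if t \<le> m + s then s < card (I \<inter> {1..min t m}) else True)"
proof -
  note fin = subset_range_card[OF I]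
  let ?l = "sorted_list_of_set I"
  show ?thesis
  proof (cases "s < card I")
    case False
    have "card (I \<inter> {1..u}) \<le> card I" for u using fin by (intro card_mono) auto
    moreover have "rev (code m I) ! s = m + 1 + s"
      using False s nth_upt[of "card I" "s - card I" m] by (simp add: code_def pad_def nth_append)
    ultimately show ?thesis using False by (simp add: not_less) (meson le_trans)
  next
    case True
    then have nth: "rev (code m I) ! s = ?l ! s" by (simp add: code_def nth_append)
    have "?l ! s \<in> I" using True fin by (metis nth_mem set_sorted_list_of_set length_sorted_list_of_set)
    then have "?l ! s \<le> m" using I by auto
    have "?l ! s \<le> u \<longleftrightarrow> s < card (I \<inter> {1..u})" for u
    proof
      assume le: "?l ! s \<le> u"
      have "set (take (Suc s) ?l) \<subseteq> I \<inter> {1..u}"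
      proof
        fix v assume "v \<in> set (take (Suc s) ?l)"
        then obtain i where i: "i \<le> s" "v = ?l ! i" by (auto simp: in_set_conv_nth less_Suc_eq_le)
        then have "v \<in> I" using True fin by (metis nth_mem set_sorted_list_of_set length_sorted_list_of_set le_less_trans)
        moreover have "v \<le> ?l ! s" using i True fin by (simp add: sorted_nth_mono)
        ultimately show "v \<in> I \<inter> {1..u}" using le I by auto
      qed
      then have "card (set (take (Suc s) ?l)) \<le> card (I \<inter> {1..u})" using fin by (intro card_mono) auto
      then show "s < card (I \<inter> {1..u})" using True by (simp add: distinct_card)
    next
      assume less: "s < card (I \<inter> {1..u})"
      show "?l ! s \<le> u"
      proof (rule ccontr)
        assume gt: "\<not> ?thesis"
        have "I \<inter> {1..u} \<subseteq> set (take s ?l)"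
        proof
          fix v assume v: "v \<in> I \<inter> {1..u}"
          then obtain i where i: "i < card I" "v = ?l ! i"
            using fin by (metis IntD1 in_set_conv_nth set_sorted_list_of_set length_sorted_list_of_set)
          have "i < s"
            using sorted_nth_mono[of ?l s i] i gt v fin by (force simp: not_less)
          then show "v \<in> set (take s ?l)" using i True by (auto simp: in_set_conv_nth)
        qed
        then have "card (I \<inter> {1..u}) \<le> card (set (take s ?l))" by (intro card_mono) auto
        also have "\<dots> \<le> s" by (metis card_length length_take min.cobounded2 min.commute order_trans)
        finally show False using less by simp
      qed
    qed
    from this[of "min t m"] have "?l ! s \<le> t \<longleftrightarrow> s < card (I \<inter> {1..min t m})"
      using \<open>?l ! s \<le> m\<close> by simp
    moreover have "?l ! s \<le> t" if "m + s < t" using \<open>?l ! s \<le> m\<close> that by linarith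
    ultimately show ?thesis unfolding nth by (cases "t \<le> m + s") auto
  qed
qed

lemma set_code: "I \<subseteq> {1..m} \<Longrightarrow> set (code m I) \<inter> {1..m} = I"
  using subset_range_card[of I m] by (auto simp: code_def pad_def)

text \<open>In a strictly increasing sequence the entries up to \<open>m\<close> form an initial
  segment, and all later ones are forced to be the padding.\<close>

lemma code_surj:
  assumes x: "length x = m" "sorted_wrt (>) x" "0 \<notin> set x"
    and pad: "\<And>s. s < m \<Longrightarrow> rev x ! s \<le> m \<or> rev x ! s = m + 1 + s"
  shows "code m (set x \<inter> {1..m}) = x"
proof -
  let ?y = "rev x" and ?I = "set x \<inter> {1..m}"
  have sorted: "sorted_wrt (<) ?y" using x by (simp add: sorted_wrt_rev)
  define k where "k = length (takeWhile (\<lambda>v. v \<le> m) ?y)"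
  have "takeWhile (\<lambda>v. v \<le> m) y = filter (\<lambda>v. v \<le> m) y" if "sorted_wrt (<) y" for y
    using that by (induction y) (force simp: filter_empty_conv empty_filter_conv)+
  note tw = this[OF sorted]
  have "set (filter (\<lambda>v. v \<le> m) ?y) = ?I" using x(3) by (auto simp: Suc_le_eq intro: gr0I)
  moreover have "sorted_wrt (<) (filter (\<lambda>v. v \<le> m) ?y)" using sorted by (rule sorted_wrt_filter)
  ultimately have list: "sorted_list_of_set ?I = takeWhile (\<lambda>v. v \<le> m) ?y"
    unfolding tw by (metis strict_sorted_equal sorted_list_of_set.set_sorted_key_list_of_set
        strict_sorted_list_of_set finite_Int finite_atLeastAtMost set_sorted_list_of_set)
  have k: "card ?I = k" by (metis k_def list length_sorted_list_of_set)
  have "k \<le> m" using length_takeWhile_le[of _ ?y] x(1) by (simp add: k_def)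
  have drop: "drop k ?y = pad m k"
  proof (rule nth_equalityI)
    show "length (drop k ?y) = length (pad m k)" using x(1) by (simp add: pad_def)
    fix i assume i: "i < length (drop k ?y)"
    then have "\<not> ?y ! k \<le> m" using nth_length_takeWhile[of "\<lambda>v. v \<le> m" ?y] x(1) unfolding k_def by simp
    moreover have "?y ! k \<le> ?y ! (k + i)"
      using sorted i x(1) by (intro sorted_nth_mono) (auto simp: strict_sorted_imp_sorted)
    ultimately have "?y ! (k + i) = m + 1 + (k + i)" using pad[of "k + i"] i x(1) by force
    then show "drop k ?y ! i = pad m k ! i" using i x(1) by (simp add: pad_def)
  qed
  have "sorted_list_of_set ?I @ pad m (card ?I) = ?y"
    unfolding list k drop[symmetric] by (simp add: k_def takeWhile_eq_take[symmetric])
       (metis append_take_drop_id takeWhile_eq_take)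
  then show ?thesis unfolding code_def by simp
qed


subsection \<open>Patterns as families of distributions\<close>

lemma nodes_iff: "(x, y) \<in> nodes L \<longleftrightarrow> 0 \<le> x \<and> 0 \<le> y \<and> (\<exists>a b. (a, b) \<in> L \<and> x \<le> a \<and> y \<le> b)"
  by (auto simp: nodes_def)

lemma nodes_down:
  "(x, y) \<in> nodes L \<Longrightarrow> 0 \<le> x' \<Longrightarrow> x' \<le> x \<Longrightarrow> 0 \<le> y' \<Longrightarrow> y' \<le> y \<Longrightarrow> (x', y') \<in> nodes L"
  unfolding nodes_iff by (meson order_trans)

lemma nodes_nonneg: "(x, y) \<in> nodes L \<Longrightarrow> 0 \<le> x \<and> 0 \<le> y"
  by (simp add: nodes_def)

lemma cells_bounds:
  assumes "(x, y) \<in> cells L"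
  shows "-1 \<le> x" "-1 \<le> y" "0 \<le> x + y + 1"
  using assms nodes_nonneg[of x "y + 1" L] nodes_nonneg[of "x + 1" y L] by (auto simp: cells_def)

text \<open>
  The weight that a decomposition of T gives to the sets whose k-th element is at most t.  Where
  the relevant cell is missing from L, its value is that of the nearest cell to the west.
\<close>

definition row_sup :: "point set \<Rightarrow> (point \<Rightarrow> real) \<Rightarrow> nat \<Rightarrow> nat \<Rightarrow> real" where
  "row_sup L T k t = Max (insert 0 {T (x, int k - 1) | x. (x, int k - 1) \<in> cells L \<and> x \<le> int t - int k})"

lemma finite_row: "finite {T (x, int k - 1) | x. (x, int k - 1) \<in> cells L \<and> x \<le> int t - int k}"
proof (rule finite_subset)
  show "{T (x, int k - 1) | x. (x, int k - 1) \<in> cells L \<and> x \<le> int t - int k}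
      \<subseteq> (\<lambda>x. T (x, int k - 1)) ` {-1..int t - int k}"
    using cells_bounds by auto
qed simp

lemma row_sup_ge:
  "(x, int k - 1) \<in> cells L \<Longrightarrow> x \<le> int t - int k \<Longrightarrow> T (x, int k - 1) \<le> row_sup L T k t"
  unfolding row_sup_def using finite_row[of T k L t] by (intro Max_ge) auto

lemma row_sup_nonneg: "0 \<le> row_sup L T k t"
  unfolding row_sup_def using finite_row[of T k L t] by (intro Max_ge) auto

lemma row_sup_le:
  assumes "0 \<le> v" "\<And>x. (x, int k - 1) \<in> cells L \<Longrightarrow> x \<le> int t - int k \<Longrightarrow> T (x, int k - 1) \<le> v"
  shows "row_sup L T k t \<le> v"
  unfolding row_sup_def using finite_row[of T k L t] assms by (subst Max_le_iff) auto

lemma row_sup_mono: "s \<le> t \<Longrightarrow> row_sup L T k s \<le> row_sup L T k t"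
  by (intro row_sup_le row_sup_nonneg row_sup_ge) auto

section \<open>Consequences of the pattern conditions for the row suprema\<close>

context
  fixes m :: nat and L :: "point set" and T :: "point \<Rightarrow> real"
  assumes L: "partial_staircase m L" and T: "T \<in> GT L"
begin

lemma origin_in_nodes: "(0, 0) \<in> nodes L"
proof -
  obtain p where p: "p \<in> L" "p \<in> staircase_sinks m" using L by (auto simp: partial_staircase_def)
  then obtain k where "k \<le> m" "p = (int m - int k, int k)" by (auto simp: staircase_sinks_def)
  then show ?thesis using p(1) unfolding nodes_iff
    by (intro conjI exI[of _ "int m - int k"] exI[of _ "int k"]) auto
qed

lemma pattern_mono_row: "(x, y) \<in> cells L \<Longrightarrow> (x', y) \<in> cells L \<Longrightarrow> x \<le> x' \<Longrightarrow> T (x, y) \<le> T (x', y)"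
  using T by (simp add: GT_def)

lemma pattern_antimono_column:
  "(x, y) \<in> cells L \<Longrightarrow> (x, y') \<in> cells L \<Longrightarrow> y' \<le> y \<Longrightarrow> T (x, y) \<le> T (x, y')"
  using T by (simp add: GT_def)

lemma pattern_west: "(-1, y) \<in> cells L \<Longrightarrow> T (-1, y) = 0"
  using T nodes_nonneg[of "-1" y L] by (auto simp: GT_def external_cells_def cell_corners_def)

text \<open>The common vertical side lacks an end node, so it is not an edge of \<open>L\<close> and
  both cells are external, hence connected.\<close>

lemma pattern_eq_next:
  assumes "(x, y) \<in> cells L" "(x + 1, y) \<in> cells L" "(x + 1, y) \<notin> nodes L \<or> (x + 1, y + 1) \<notin> nodes L"
  shows "T (x, y) = T (x + 1, y)"
proof -
  let ?e = "{(x + 1, y), (x + 1, y + 1)}"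
  have "?e \<notin> edges L"
    using assms(3) by (auto simp: edges_def doubleton_eq_iff)
  moreover have "?e \<in> cell_edges (x, y) \<inter> cell_edges (x + 1, y)" by (simp add: cell_edges_def)
  ultimately have "connected_cells L (x, y) (x + 1, y)"
    using assms unfolding connected_cells_def by (auto simp: external_cells_def cell_corners_def)
  then show ?thesis using T by (simp add: GT_def)
qed

lemma pattern_eq_above:
  assumes "(x, y) \<in> cells L" "(x, y + 1) \<in> cells L" "(x + 1, y + 1) \<notin> nodes L"
  shows "T (x, y) = T (x, y + 1)"
proof -
  let ?e = "{(x, y + 1), (x + 1, y + 1)}"
  have "?e \<notin> edges L"
    using assms(3) by (auto simp: edges_def doubleton_eq_iff)
  moreover have "?e \<in> cell_edges (x, y) \<inter> cell_edges (x, y + 1)" by (simp add: cell_edges_def)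
  ultimately have "connected_cells L (x, y) (x, y + 1)"
    using assms unfolding connected_cells_def by (auto simp: external_cells_def cell_corners_def)
  then show ?thesis using T by (simp add: GT_def)
qed

text \<open>East of a cell whose northeast corner lies outside, the upper ends of all vertical sides
  lie outside too, so the cells form a chain of connected external cells.\<close>

lemma pattern_eq_outside:
  assumes "(x, y) \<in> cells L" "(x', y) \<in> cells L" "x \<le> x'" "(x + 1, y + 1) \<notin> nodes L"
  shows "T (x, y) = T (x', y)"
proof -
  note bounds = cells_bounds[OF assms(1)]
  have out: "(z + 1, y + 1) \<notin> nodes L" if "x \<le> z" for z
    using assms(4) nodes_down[of "z + 1" "y + 1" L "x + 1" "y + 1"] bounds that by auto
  have cell: "(z, y) \<in> cells L" if "x \<le> z" "z \<le> x'" for z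
  proof (cases "x = x'")
    case True
    then show ?thesis using that assms by simp
  next
    case False
    then have "(x' + 1, y) \<in> nodes L" using assms(2,3) out[of "x' - 1"] by (auto simp: cells_def)
    then have "(z + 1, y) \<in> nodes L"
      using that bounds nodes_down[of "x' + 1" y L "z + 1" y] nodes_nonneg[of "x' + 1" y L] by auto
    then show ?thesis by (simp add: cells_def)
  qed
  have "z \<le> x' \<longrightarrow> T (x, y) = T (z, y)" if "x \<le> z" for z
    using that
  proof (induction z rule: int_ge_induct)
    case base
    then show ?case by simp
  next
    case (step z)
    then show ?case using pattern_eq_next[of z y] cell[of z] cell[of "z + 1"] out[of z] by auto
  qed
  then show ?thesis using assms(3) by blast
qed

text \<open>The cells below \<open>L\<close> are connected through vertical sides that descend to
  height -1, where there are no nodes. Their common value is the total weight of a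
  decomposition.\<close>

lemma pattern_bottom:
  assumes "(x, -1) \<in> cells L"
  shows "T (x, -1) = T (0, -1)"
proof -
  have node: "(x, 0) \<in> nodes L" using assms nodes_nonneg[of "x + 1" "-1" L] by (auto simp: cells_def)
  then have "0 \<le> x" using nodes_nonneg by blast
  moreover have "z \<le> x \<longrightarrow> T (0, -1) = T (z, -1)" if "0 \<le> z" for z
    using that
  proof (induction z rule: int_ge_induct)
    case base
    then show ?case by simp
  next
    case (step z)
    show ?case
    proof
      assume "z + 1 \<le> x"
      then have "(z, 0) \<in> nodes L" "(z + 1, 0) \<in> nodes L"
        using step.hyps nodes_down[OF node] by auto
      then have "T (z, -1) = T (z + 1, -1)"
        using nodes_nonneg[of "z + 1" "-1" L] by (intro pattern_eq_next) (auto simp: cells_def)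
      then show "T (0, -1) = T (z + 1, -1)" using step \<open>z + 1 \<le> x\<close> by simp
    qed
  qed
  ultimately show ?thesis by simp
qed

lemma row_sup_cell:
  assumes "(int t - int k, int k - 1) \<in> cells L"
  shows "row_sup L T k t = T (int t - int k, int k - 1)"
proof (rule antisym)
  show "row_sup L T k t \<le> T (int t - int k, int k - 1)"
    using T assms pattern_mono_row by (intro row_sup_le) (auto simp: GT_def)
qed (use assms row_sup_ge[of "int t - int k"] in auto)

text \<open>Only the column \<open>x = -1\<close> is far enough west, and it holds 0;
  correspondingly, the \<open>k\<close>-th element of a set is at least \<open>k\<close>.\<close>

lemma row_sup_zero:
  assumes "t < k"
  shows "row_sup L T k t = 0"
proof (rule antisym[OF row_sup_le row_sup_nonneg])
  fix x assume "(x, int k - 1) \<in> cells L" "x \<le> int t - int k"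
  moreover from this have "x = -1" using cells_bounds(1) assms by fastforce
  ultimately show "T (x, int k - 1) \<le> 0" using pattern_west by simp
qed simp

lemma row_sup_0: "row_sup L T 0 t = row_sup L T 0 0"
proof -
  have cell: "(0, -1) \<in> cells L" using origin_in_nodes by (simp add: cells_def)
  have "row_sup L T 0 t = T (0, -1)" for t
  proof (rule antisym[OF row_sup_le])
    show "0 \<le> T (0, -1)" using T cell by (auto simp: GT_def)
    show "T (x, int 0 - 1) \<le> T (0, -1)" if "(x, int 0 - 1) \<in> cells L" for x
      using pattern_bottom[of x] that by simp
    show "T (0, -1) \<le> row_sup L T 0 t" using row_sup_ge[of 0 0 L t T] cell by simp
  qed
  then show ?thesis by metis
qed

text \<open>Both sides range over \<open>x \<le> int t - int k\<close>, so the column inequality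
  compares them cell by cell; the column \<open>x = -1\<close> contributes 0.\<close>

lemma row_sup_Suc: "row_sup L T (Suc k) (Suc t) \<le> row_sup L T k t"
proof (rule row_sup_le[OF row_sup_nonneg])
  fix x assume cell: "(x, int (Suc k) - 1) \<in> cells L" and le: "x \<le> int (Suc t) - int (Suc k)"
  show "T (x, int (Suc k) - 1) \<le> row_sup L T k t"
  proof (cases "x = -1")
    case True
    then show ?thesis using cell pattern_west row_sup_nonneg by simp
  next
    case False
    then have "0 \<le> x" using cells_bounds(1)[OF cell] by simp
    have "(x, int k - 1) \<in> cells L"
    proof (cases "k = 0")
      case True
      then show ?thesis
        using cell \<open>0 \<le> x\<close> nodes_down[of x 1 L x 0] nodes_down[of "x + 1" 0 L x 0] by (auto simp: cells_def)
    next
      case False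
      then show ?thesis
        using cell \<open>0 \<le> x\<close> nodes_down[of x "int k + 1" L x "int k"]
          nodes_down[of "x + 1" "int k" L "x + 1" "int k - 1"] by (auto simp: cells_def)
    qed
    moreover from this have "T (x, int (Suc k) - 1) \<le> T (x, int k - 1)"
      using cell by (intro pattern_antimono_column) auto
    ultimately show ?thesis using row_sup_ge[of x k L t T] le by simp
  qed
qed

lemma sink_sum: "(a, b) \<in> L \<Longrightarrow> a + b = int m"
  using L by (auto simp: partial_staircase_def staircase_sinks_def)

text \<open>This forces sets with exactly \<open>k\<close> elements to have weight 0: the weights of
  at least \<open>k\<close> and of at least \<open>k + 1\<close> elements cannot differ at an
  unselected sink.\<close>

lemma row_sup_unselected:
  assumes "(int m - int k, int k) \<notin> L"
  shows "row_sup L T k m \<le> row_sup L T (Suc k) m"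
proof (rule row_sup_le[OF row_sup_nonneg])
  fix x assume cell: "(x, int k - 1) \<in> cells L"
  show "T (x, int k - 1) \<le> row_sup L T (Suc k) m"
  proof (cases "(0, int k) \<in> nodes L")
    \<comment> \<open>All cells of row \<open>k - 1\<close> are joined to its westmost cell, which
      holds 0.\<close>
    case False
    then have "k \<noteq> 0" using origin_in_nodes by (metis of_nat_0)
    have "(x, int k) \<notin> nodes L"
      using False nodes_down[of x "int k" L 0 "int k"] nodes_nonneg[of x "int k" L] by auto
    then have "(x + 1, int k - 1) \<in> nodes L" using cell by (simp add: cells_def)
    then have "(0, int k - 1) \<in> nodes L"
      using nodes_down[of "x + 1" "int k - 1" L 0] nodes_nonneg[of "x + 1" "int k - 1" L] by auto
    then have "(-1, int k - 1) \<in> cells L" by (simp add: cells_def)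
    moreover from this have "T (-1, int k - 1) = T (x, int k - 1)"
      using cell cells_bounds(1) False by (intro pattern_eq_outside) auto
    ultimately show ?thesis using pattern_west row_sup_nonneg by metis
  next
    case True
    \<comment> \<open>\<open>(w, k)\<close> is the last node at height \<open>k\<close>. A sink
      above it differs from \<open>(m - k, k)\<close>, so it is higher and \<open>(w, k + 1)\<close>
      is a node too; the cells below and above the missing edge east of \<open>(w, k)\<close> are
      then connected.\<close>
    define w where "w = Max {x. (x, int k) \<in> nodes L}"
    have "{x. (x, int k) \<in> nodes L} \<subseteq> {0..int m}"
      using sink_sum by (fastforce simp: nodes_def)
    then have fin: "finite {x. (x, int k) \<in> nodes L}" by (rule finite_subset) simp
    then have w: "(w, int k) \<in> nodes L" using True Max_in[OF fin] by (auto simp: w_def)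
    have w1: "(w + 1, int k) \<notin> nodes L" using Max_ge[OF fin, of "w + 1"] by (auto simp: w_def)
    obtain a b where ab: "(a, b) \<in> L" "0 \<le> w" "w \<le> a" "int k \<le> b" using w by (auto simp: nodes_def)
    have "b \<noteq> int k" using ab(1) assms sink_sum[OF ab(1)] by (metis add_diff_cancel_right')
    then have "(w, int k + 1) \<in> nodes L"
      using ab unfolding nodes_iff by (intro conjI exI[of _ a] exI[of _ b]) auto
    then have above: "(w, int k) \<in> cells L" by (simp add: cells_def)
    have below: "(w, int k - 1) \<in> cells L" using w by (simp add: cells_def)
    have "T (w, int k - 1) = T (w, int k)"
      using pattern_eq_above[of w "int k - 1"] above below w1 by simp
    moreover have "T (w, int k) \<le> row_sup L T (Suc k) m"
      using row_sup_ge[of w "Suc k" L m T] above sink_sum[OF ab(1)] ab \<open>b \<noteq> int k\<close> by simp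
    moreover have "T (x, int k - 1) \<le> T (w, int k - 1)"
    proof (cases "x \<le> w")
      case True
      then show ?thesis using pattern_mono_row cell below by blast
    next
      case False
      then show ?thesis using pattern_eq_outside[OF below cell] w1 by simp
    qed
    ultimately show ?thesis by simp
  qed
qed

end

section \<open>Decompositions in terms of masses\<close>

definition mass :: "nat \<Rightarrow> (nat set \<Rightarrow> real) \<Rightarrow> nat \<Rightarrow> nat \<Rightarrow> real" where
  "mass m c k t = (\<Sum>I\<in>Pow {1..m}. if k \<le> card (I \<inter> {1..t}) then c I else 0)"

text \<open>The path ends on the line \<open>x + y = m\<close>, whose nodes are exactly the selected
  sinks; nodes are closed downwards, so the end point decides.\<close>

lemma path_sets_iff:
  assumes L: "partial_staircase m L" and I: "I \<subseteq> {1..m}"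
  shows "I \<in> path_sets m L \<longleftrightarrow> (int m - int (card I), int (card I)) \<in> L"
proof -
  have "{1..m} \<inter> I = I" using I by auto
  then have snd: "snd (path_node I m) = int (card I)" by (simp add: path_node_def)
  then have fst: "fst (path_node I m) = int m - int (card I)" using path_node_sum[of I m] by simp
  show ?thesis
  proof
    assume "I \<in> path_sets m L"
    then have "path_node I m \<in> nodes L" by (auto simp: path_sets_def lattice_path_def)
    then obtain a b where "(a, b) \<in> L" "int m - int (card I) \<le> a" "int (card I) \<le> b"
      using fst snd by (cases "path_node I m") (auto simp: nodes_def)
    then show "(int m - int (card I), int (card I)) \<in> L"
      using L by (auto simp: partial_staircase_def staircase_sinks_def)
  next
    assume sink: "(int m - int (card I), int (card I)) \<in> L"
    have "path_node I t \<in> nodes L" if "t \<le> m" for t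
    proof -
      have "0 \<le> fst (path_node I t)" "0 \<le> snd (path_node I t)" by (simp_all add: path_node_def)
      then show ?thesis
        using path_node_mono[OF that, of I] sink fst snd
        by (cases "path_node I t") (auto simp: nodes_def intro!: bexI[OF _ sink])
    qed
    then show "I \<in> path_sets m L" using I by (auto simp: path_sets_def lattice_path_def)
  qed
qed

text \<open>Every cell has this form, with \<open>t\<close> its diagonal. For \<open>k > 0\<close>
  the value 1 means that the \<open>k\<close>-th element of \<open>I\<close> is at most
  \<open>t\<close>; the row \<open>k = 0\<close> lies southeast of all paths.\<close>

lemma path_pattern_cell:
  assumes "(int t - int k, int k - 1) \<in> cells L" "t \<le> m"
  shows "path_pattern L (lattice_path m I) (int t - int k, int k - 1) =
    (if k \<le> card (I \<inter> {1..t}) then 1 else 0)"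
proof -
  have "southeast_of (lattice_path m I) (int t - int k, int k - 1) \<longleftrightarrow>
      fst (path_node I t) \<le> int t - int k"
    using assms(2) by (intro southeast_iff) auto
  moreover have "snd (path_node I t) = int (card (I \<inter> {1..t}))"
    by (simp add: path_node_def Int_commute)
  ultimately show ?thesis
    using assms path_node_sum[of I t] by (auto simp: path_pattern_def)
qed

lemma mass_mono:
  assumes "\<And>I. 0 \<le> c I" "s \<le> t"
  shows "mass m c k s \<le> mass m c k t"
  unfolding mass_def
proof (rule sum_mono)
  fix I
  have "card (I \<inter> {1..s}) \<le> card (I \<inter> {1..t})" using assms(2) by (intro card_mono) auto
  then show "(if k \<le> card (I \<inter> {1..s}) then c I else 0) \<le> (if k \<le> card (I \<inter> {1..t}) then c I else 0)"
    using assms(1) by auto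
qed

lemma cellE:
  assumes "partial_staircase m L" "z \<in> cells L"
  obtains k t where "z = (int t - int k, int k - 1)" "t \<le> m"
proof -
  obtain x y where z: "z = (x, y)" by force
  obtain t where t: "t \<le> m" "int t = x + y + 1" using cells_diagonal assms z by metis
  have "-1 \<le> y" using assms z cells_bounds by blast
  then show thesis using that[of t "nat (y + 1)"] t z by simp
qed

text \<open>On cells of \<open>L\<close> the two sides match by \<open>path_pattern_cell\<close>.
  The point is that masses are also determined where the cell is missing: paths inside
  \<open>L\<close> cannot add mass there, just as \<open>row_sup\<close> does not grow.\<close>

lemma decomposition_iff_mass:
  assumes L: "partial_staircase m L" and T: "T \<in> GT L"
    and c: "\<And>I. 0 \<le> c I" "\<And>I. c I \<noteq> 0 \<Longrightarrow> I \<in> path_sets m L"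
  shows "T = (\<lambda>z. \<Sum>I\<in>Pow {1..m}. c I * path_pattern L (lattice_path m I) z) \<longleftrightarrow>
    (\<forall>k t. t \<le> m \<longrightarrow> mass m c k t = row_sup L T k t)" (is "T = ?S \<longleftrightarrow> _")
proof -
  have S: "?S (int t - int k, int k - 1) = mass m c k t"
    if "(int t - int k, int k - 1) \<in> cells L" "t \<le> m" for k t
    unfolding mass_def by (intro sum.cong) (auto simp: path_pattern_cell[OF that])
  have S_out: "?S z = 0" "T z = 0" if "z \<notin> cells L" for z
    using that T by (simp add: path_pattern_def) (cases z, use that T in \<open>simp add: GT_def\<close>)
  show ?thesis
  proof
    assume eq: "\<forall>k t. t \<le> m \<longrightarrow> mass m c k t = row_sup L T k t"
    have "T z = ?S z" for z
    proof (cases "z \<in> cells L")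
      case True
      then obtain k t where kt: "z = (int t - int k, int k - 1)" "t \<le> m" using cellE[OF L] by metis
      have "T z = row_sup L T k t" using row_sup_cell[OF L T] True unfolding kt(1) by metis
      also have "\<dots> = mass m c k t" using eq kt(2) by metis
      also have "\<dots> = ?S z" using S True kt(2) unfolding kt(1) by metis
      finally show ?thesis .
    next
      case False
      then show ?thesis using S_out by metis
    qed
    then show "T = ?S" by (rule ext)
  next
    assume eq: "T = ?S"
    have cell: "T (int t - int k, int k - 1) = mass m c k t"
      if "(int t - int k, int k - 1) \<in> cells L" "t \<le> m" for k t
      using trans[OF fun_cong[OF eq] S[OF that]] .
    have "row_sup L T k t \<le> mass m c k t" if "t \<le> m" for k t
    proof (rule row_sup_le)
      show "0 \<le> mass m c k t" unfolding mass_def using c(1) by (intro sum_nonneg) auto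
      fix x assume x: "(x, int k - 1) \<in> cells L" "x \<le> int t - int k"
      \<comment> \<open>The cell at \<open>x\<close> lies on diagonal \<open>s \<le> t\<close>, and
        masses grow with the diagonal.\<close>
      define s where "s = nat (x + int k)"
      have "int s = x + int k" using cells_bounds(3)[OF x(1)] by (simp add: s_def)
      then have s: "x = int s - int k" "s \<le> t" using x(2) by auto
      then show "T (x, int k - 1) \<le> mass m c k t"
        using cell[of s k] x(1) that mass_mono[OF c(1) s(2)] by simp
    qed
    moreover have "mass m c k t \<le> row_sup L T k t" if "t \<le> m" for k t
      using that
    proof (induction t)
      case 0
      show ?case
      proof (cases "k = 0")
        case True
        have "(0, -1) \<in> cells L" using origin_in_nodes[OF L T] by (simp add: cells_def)
        then show ?thesis using cell[of 0 0] row_sup_cell[OF L T, of 0 0] True by simp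
      next
        case False
        then show ?thesis using row_sup_nonneg by (simp add: mass_def)
      qed
    next
      case (Suc t)
      show ?case
      proof (cases "(int (Suc t) - int k, int k - 1) \<in> cells L")
        case True
        then show ?thesis using cell[OF True Suc.prems] row_sup_cell[OF L T True] by simp
      next
        case False
        \<comment> \<open>If the \<open>k\<close>-th element of \<open>I\<close> were
          \<open>Suc t\<close>, the path would pass through \<open>(Suc t - k, k)\<close>, the
          northwest corner of the cell, and the cell would be in \<open>L\<close>.\<close>
        have "mass m c k (Suc t) \<le> mass m c k t"
          unfolding mass_def
        proof (rule sum_mono)
          fix I assume "I \<in> Pow {1..m}"
          have "k \<le> card (I \<inter> {1..t})" if k: "k \<le> card (I \<inter> {1..Suc t})" and "c I \<noteq> 0"
          proof (rule ccontr)
            assume less: "\<not> ?thesis"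
            have "card (I \<inter> {1..Suc t}) \<le> card (insert (Suc t) (I \<inter> {1..t}))"
              by (intro card_mono) (auto simp: le_Suc_eq)
            then have "card (I \<inter> {1..Suc t}) = k" using k less card_insert_le_m1 by (auto simp: card_insert_if)
            then have "snd (path_node I (Suc t)) = int k" by (simp add: path_node_def Int_commute)
            then have "path_node I (Suc t) = (int (Suc t) - int k, int k)"
              using path_node_sum[of I "Suc t"] by (cases "path_node I (Suc t)") auto
            moreover have "path_node I (Suc t) \<in> nodes L"
              using c(2)[OF \<open>c I \<noteq> 0\<close>] Suc.prems by (auto simp: path_sets_def lattice_path_def)
            ultimately show False using False by (simp add: cells_def)
          qed
          then show "(if k \<le> card (I \<inter> {1..Suc t}) then c I else 0) \<le> (if k \<le> card (I \<inter> {1..t}) then c I else 0)"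
            using c(1)[of I] by auto
        qed
        also have "\<dots> \<le> row_sup L T k t" using Suc by simp
        also have "\<dots> \<le> row_sup L T k (Suc t)" by (rule row_sup_mono) simp
        finally show ?thesis .
      qed
    qed
    ultimately show "\<forall>k t. t \<le> m \<longrightarrow> mass m c k t = row_sup L T k t"
      by (intro allI impI antisym)
  qed
qed


subsection \<open>Existence and uniqueness of the decomposition\<close>

text \<open>The distribution function of the entry at position \<open>s\<close> of padded sequences,
  when \<open>w k t\<close> is the weight of the sets whose \<open>k\<close>-th element is at most
  \<open>t\<close>: constant from \<open>m\<close> to \<open>m + s\<close>, it jumps to the total
  \<open>w 0 0\<close> at the padding entry \<open>m + 1 + s\<close>.\<close>

definition level :: "nat \<Rightarrow> (nat \<Rightarrow> nat \<Rightarrow> real) \<Rightarrow> nat \<Rightarrow> nat \<Rightarrow> real" where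
  "level m w s t = (if t \<le> m + s then w (Suc s) (min t m) else w 0 0)"

definition coded :: "nat \<Rightarrow> (nat set \<Rightarrow> real) \<Rightarrow> nat list \<Rightarrow> real" where
  "coded m c x = (if x \<in> code m ` Pow {1..m} then c (set x \<inter> {1..m}) else 0)"

lemma nested_refl: "nested x x"
  by (induction x) (auto simp: nested_step_def)

lemma coded_code: "I \<subseteq> {1..m} \<Longrightarrow> coded m c (code m I) = c I"
  using set_code[of I m] by (simp add: coded_def)

lemma sum_coded:
  "(\<Sum>x\<in>seqs (2 * m) m. if P x then coded m c x else 0) =
   (\<Sum>I\<in>Pow {1..m}. if P (code m I) then c I else 0)"
proof -
  have "inj_on (code m) (Pow {1..m})"
    by (rule inj_on_inverseI[where g = "\<lambda>x. set x \<inter> {1..m}"]) (use set_code in auto)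
  then have "(\<Sum>I\<in>Pow {1..m}. if P (code m I) then c I else 0) =
      (\<Sum>x\<in>code m ` Pow {1..m}. if P x then coded m c x else 0)"
    by (subst sum.reindex) (auto simp: coded_code intro!: sum.cong)
  also have "\<dots> = (\<Sum>x\<in>seqs (2 * m) m. if P x then coded m c x else 0)"
    using code_in_seqs by (intro sum.mono_neutral_left) (auto simp: coded_def)
  finally show ?thesis by simp
qed

lemma cumulative_coded:
  "s < m \<Longrightarrow> cumulative (2 * m) m (coded m c) s t = level m (mass m c) s t"
  unfolding cumulative_def sum_coded level_def mass_def
  by (auto simp: code_nth_le_iff Suc_le_eq intro!: sum.cong)

lemma total_coded: "sum (coded m c) (seqs (2 * m) m) = mass m c 0 t"
  using sum_coded[of "\<lambda>_. True" m c] by (simp add: mass_def)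

lemma nested_weights_coded:
  assumes "\<And>I. 0 \<le> c I" "pairwise non_crossing {I \<in> Pow {1..m}. 0 < c I}"
  shows "nested_weights (2 * m) m (coded m c)"
  unfolding nested_weights_def
proof (intro conjI allI impI)
  show "0 \<le> coded m c x" for x using assms(1) by (simp add: coded_def)
  show "x \<in> seqs (2 * m) m" "sorted_wrt (>) x" if "0 < coded m c x" for x
    using that code_in_seqs sorted_code by (auto simp: coded_def split: if_splits)
  show "nested x y" if xy: "0 < coded m c x" "0 < coded m c y" for x y
  proof -
    obtain I J where IJ: "x = code m I" "I \<subseteq> {1..m}" "y = code m J" "J \<subseteq> {1..m}"
      using xy by (auto simp: coded_def split: if_splits)
    then have "0 < c I" "0 < c J" using xy by (simp_all add: coded_code)
    then have "I = J \<or> non_crossing I J" using assms(2) IJ by (auto simp: pairwise_def)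
    then show ?thesis using IJ non_crossing_iff_nested nested_refl by auto
  qed
qed

lemma level_mono:
  assumes L: "partial_staircase m L" and T: "T \<in> GT L"
  shows "mono (level m (row_sup L T) s)"
proof -
  \<comment> \<open>This makes the final jump of \<open>level\<close> go upwards. Lowering
    \<open>k\<close> and \<open>t\<close> together by \<open>row_sup_Suc\<close> ends at
    \<open>k = 0\<close> or at the value 0.\<close>
  have "row_sup L T k t \<le> row_sup L T 0 0" for k t
  proof (induction k arbitrary: t)
    case 0
    then show ?case using row_sup_0[OF L T, of t] by simp
  next
    case (Suc k)
    show ?case
    proof (cases t)
      case 0
      then show ?thesis using row_sup_zero[OF L T, of 0 "Suc k"] row_sup_nonneg by simp
    next
      case (Suc u)
      then show ?thesis using row_sup_Suc[OF L T, of k u] Suc.IH[of u] by simp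
    qed
  qed
  then show ?thesis
    by (auto simp: level_def mono_def intro!: row_sup_mono)
qed

text \<open>Padding entries grow by one from each position to the next, so the jumps keep step;
  below them \<open>row_sup_Suc\<close> applies.\<close>

lemma level_Suc:
  assumes L: "partial_staircase m L" and T: "T \<in> GT L"
  shows "level m (row_sup L T) (Suc s) (Suc t) \<le> level m (row_sup L T) s t"
proof (cases "t \<le> m + s")
  case True
  have "row_sup L T (Suc (Suc s)) (min (Suc t) m) \<le> row_sup L T (Suc s) (min t m)"
  proof (cases m)
    case 0
    then show ?thesis using row_sup_zero[OF L T, of 0] row_sup_nonneg by simp
  next
    case (Suc u)
    then have "row_sup L T (Suc (Suc s)) (min (Suc t) m) \<le> row_sup L T (Suc s) (min t u)"
      using row_sup_Suc[OF L T] by simp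
    also have "\<dots> \<le> row_sup L T (Suc s) (min t m)" using Suc by (intro row_sup_mono) simp
    finally show ?thesis .
  qed
  then show ?thesis using True by (simp add: level_def)
qed (simp add: level_def)

text \<open>Nested weights with the required distributions exist on sequences. Two facts lead back
  to sets with paths in \<open>L\<close>: the distributions have no mass above \<open>m\<close>
  except at the padding entries, and none on cardinalities of unselected sinks.\<close>

lemma weights_exist:
  assumes L: "partial_staircase m L" and T: "T \<in> GT L"
  obtains c where "\<And>I. 0 \<le> c I" "\<And>I. 0 < c I \<Longrightarrow> I \<in> path_sets m L"
    "\<And>I J. 0 < c I \<Longrightarrow> 0 < c J \<Longrightarrow> non_crossing I J"
    "\<And>k t. t \<le> m \<Longrightarrow> mass m c k t = row_sup L T k t"
proof -
  let ?H = "level m (row_sup L T)"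
  have "\<exists>w. nested_weights (2 * m) m w \<and> sum w (seqs (2 * m) m) = row_sup L T 0 0 \<and>
      (\<forall>s<m. \<forall>t. cumulative (2 * m) m w s t = ?H s t)"
  proof (rule nested_weights_exist)
    show "?H s 0 = 0" for s using row_sup_zero[OF L T, of 0 "Suc s"] by (simp add: level_def)
    show "?H s t = row_sup L T 0 0" if "s < m" "2 * m \<le> t" for s t
      using that by (simp add: level_def)
  qed (use level_mono[OF L T] level_Suc[OF L T] row_sup_nonneg in auto)
  then obtain w where w: "nested_weights (2 * m) m w" "sum w (seqs (2 * m) m) = row_sup L T 0 0"
    "\<And>s t. s < m \<Longrightarrow> cumulative (2 * m) m w s t = ?H s t"
    by blast
  have nonneg: "0 \<le> w x" for x using w(1) by (simp add: nested_weights_def)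
  have support: "x \<in> seqs (2 * m) m" "sorted_wrt (>) x" if "0 < w x" for x
    using w(1) that by (auto simp: nested_weights_def)
  \<comment> \<open>\<open>level\<close> does not increase at a value above \<open>m\<close> other
    than \<open>m + 1 + s\<close>, so no sequence with such an entry at \<open>s\<close> has
    positive weight.\<close>
  have image: "x \<in> code m ` Pow {1..m}" if pos: "0 < w x" for x
  proof -
    have "rev x ! s \<le> m \<or> rev x ! s = m + 1 + s" if s: "s < m" for s
    proof (rule ccontr)
      assume bad: "\<not> ?thesis"
      define v where "v = rev x ! s"
      have "cumulative (2 * m) m w s (v - 1) < cumulative (2 * m) m w s v"
        unfolding cumulative_def
      proof (rule sum_strict_mono_ex1)
        show "\<exists>x\<in>seqs (2 * m) m.
            (if rev x ! s \<le> v - 1 then w x else 0) < (if rev x ! s \<le> v then w x else 0)"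
          using support(1)[OF pos] pos bad by (intro bexI[of _ x]) (auto simp: v_def)
      qed (use nonneg in auto)
      moreover have "?H s (v - 1) = ?H s v" using bad by (auto simp: level_def v_def)
      ultimately show False using w(3)[OF s] by simp
    qed
    then have "code m (set x \<inter> {1..m}) = x"
      using support[OF pos] by (intro code_surj) (auto simp: seqs_def)
    then show ?thesis by (metis Int_lower2 PowI image_eqI)
  qed
  define c where "c I = (if I \<subseteq> {1..m} then w (code m I) else 0)" for I
  have "coded m c x = w x" for x
  proof (cases "x \<in> code m ` Pow {1..m}")
    case True
    then show ?thesis by (auto simp: coded_code c_def)
  next
    case False
    then show ?thesis using image[of x] nonneg[of x] by (auto simp: coded_def order.order_iff_strict)
  qed
  then have coded: "coded m c = w" by blast
  have c_nonneg: "0 \<le> c I" for I using nonneg by (simp add: c_def)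
  have mass: "mass m c k t = row_sup L T k t" if t: "t \<le> m" for k t
  proof (cases k)
    case 0
    then show ?thesis using total_coded[of m c t] w(2) row_sup_0[OF L T, of t] coded by simp
  next
    case (Suc s)
    show ?thesis
    proof (cases "s < m")
      case True
      then show ?thesis
        using cumulative_coded[OF True, of c t] w(3)[OF True, of t] t Suc coded by (simp add: level_def)
    next
      case False
      have "card (I \<inter> {1..t}) \<le> t" for I using card_mono[of "{1..t}" "I \<inter> {1..t}"] by simp
      then have "\<not> k \<le> card (I \<inter> {1..t})" for I
        using False t Suc by (metis le_trans not_less_eq_eq not_less)
      then have "mass m c k t = 0" by (simp add: mass_def)
      then show ?thesis using row_sup_zero[OF L T, of t k] False t Suc by simp
    qed
  qed
  \<comment> \<open>The weight of \<open>I\<close> makes the mass at \<open>m\<close> drop from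
    \<open>card I\<close> to \<open>Suc (card I)\<close>, which \<open>row_sup_unselected\<close>
    excludes at an unselected sink.\<close>
  have "I \<in> path_sets m L" if pos: "0 < c I" for I
  proof (rule ccontr)
    assume "\<not> ?thesis"
    have I: "I \<subseteq> {1..m}" using pos by (simp add: c_def split: if_splits)
    let ?k = "card I"
    have Int: "I \<inter> {1..m} = I" using I by blast
    have "mass m c (Suc ?k) m < mass m c ?k m"
      unfolding mass_def
    proof (rule sum_strict_mono_ex1)
      show "\<exists>J\<in>Pow {1..m}. (if Suc ?k \<le> card (J \<inter> {1..m}) then c J else 0) <
          (if ?k \<le> card (J \<inter> {1..m}) then c J else 0)"
        using I pos Int by (intro bexI[of _ I]) auto
    qed (use c_nonneg in auto)
    moreover have "row_sup L T ?k m \<le> row_sup L T (Suc ?k) m"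
      using \<open>I \<notin> path_sets m L\<close> path_sets_iff[OF L I] by (intro row_sup_unselected[OF L T]) simp
    ultimately show False using mass by simp
  qed
  moreover have "non_crossing I J" if "0 < c I" "0 < c J" for I J
    using that w(1) non_crossing_iff_nested[of I m J]
    by (auto simp: c_def nested_weights_def split: if_splits)
  ultimately show thesis using that[OF c_nonneg _ _ mass] by blast
qed

lemma weights_unique:
  assumes "\<And>I. 0 \<le> c I" "pairwise non_crossing {I \<in> Pow {1..m}. 0 < c I}"
    and "\<And>I. 0 \<le> c' I" "pairwise non_crossing {I \<in> Pow {1..m}. 0 < c' I}"
    and mass: "\<And>k t. t \<le> m \<Longrightarrow> mass m c k t = mass m c' k t"
    and "I \<subseteq> {1..m}"
  shows "c I = c' I"
proof -
  have "coded m c = coded m c'"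
  proof (rule nested_weights_unique)
    show "sum (coded m c) (seqs (2 * m) m) = sum (coded m c') (seqs (2 * m) m)"
      using mass[of 0 0] by (simp add: total_coded[of m _ 0])
    show "cumulative (2 * m) m (coded m c) s t = cumulative (2 * m) m (coded m c') s t" if "s < m" for s t
      using mass by (simp add: cumulative_coded[OF that] level_def)
  qed (use assms(1-4) nested_weights_coded in auto)
  then show ?thesis using assms(6) by (metis coded_code)
qed

theorem corollary7p2:
  fixes m :: nat and L :: "(int \<times> int) set"
  assumes "m \<ge> 1" and "partial_staircase m L"
  shows "\<forall>T \<in> GT L. \<exists>!(F, c :: nat set \<Rightarrow> real).
    F \<in> nc_complex m L \<and>
    (\<forall>I \<in> F. c I > 0) \<and> (\<forall>I. I \<notin> F \<longrightarrow> c I = 0) \<and>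
    T = (\<lambda>z. \<Sum>I\<in>F. c I * path_pattern L (lattice_path m I) z)"
proof
  fix T assume T: "T \<in> GT L"
  note L = assms(2)
  define D where "D F c \<longleftrightarrow> F \<in> nc_complex m L \<and> (\<forall>I \<in> F. c I > 0) \<and> (\<forall>I. I \<notin> F \<longrightarrow> c I = 0) \<and>
    T = (\<lambda>z. \<Sum>I\<in>F. c I * path_pattern L (lattice_path m I) z)" for F and c :: "nat set \<Rightarrow> real"
  \<comment> \<open>Positivity on \<open>F\<close> and vanishing off \<open>F\<close> make
    \<open>F\<close> the support of \<open>c\<close>, so only \<open>c\<close> has to be determined,
    and the sum may run over all subsets of \<open>{1..m}\<close>.\<close>
  have D_iff: "D F c \<longleftrightarrow> F = {I. 0 < c I} \<and> (\<forall>I. 0 \<le> c I) \<and> F \<subseteq> path_sets m L \<and>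
      pairwise non_crossing F \<and> (\<forall>k t. t \<le> m \<longrightarrow> mass m c k t = row_sup L T k t)" for F c
  proof (cases "F = {I. 0 < c I} \<and> (\<forall>I. 0 \<le> c I) \<and> F \<subseteq> path_sets m L")
    case False
    have "F = {I. 0 < c I} \<and> (\<forall>I. 0 \<le> c I) \<and> F \<subseteq> path_sets m L" if "D F c"
    proof -
      have F: "F \<subseteq> path_sets m L" and pos: "\<And>I. I \<in> F \<Longrightarrow> 0 < c I" and zero: "\<And>I. I \<notin> F \<Longrightarrow> c I = 0"
        using that unfolding D_def nc_complex_def by blast+
      have "0 \<le> c I" "I \<in> F \<longleftrightarrow> 0 < c I" for I using pos[of I] zero[of I] by (cases "I \<in> F"; simp)+
      then show ?thesis using F by blast
    qed
    then show ?thesis using False by blast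
  next
    case True
    have pos: "\<forall>I\<in>F. 0 < c I" and zero: "\<forall>I. I \<notin> F \<longrightarrow> c I = 0"
      using True by (auto intro: antisym simp: not_less)
    have "F \<subseteq> Pow {1..m}" using True by (auto simp: path_sets_def)
    then have sum: "(\<Sum>I\<in>F. c I * path_pattern L (lattice_path m I) z) =
        (\<Sum>I\<in>Pow {1..m}. c I * path_pattern L (lattice_path m I) z)" for z
      using zero by (intro sum.mono_neutral_left) auto
    have sub: "F \<subseteq> path_sets m L" using True by blast
    have D: "D F c \<longleftrightarrow> pairwise non_crossing F \<and>
        T = (\<lambda>z. \<Sum>I\<in>Pow {1..m}. c I * path_pattern L (lattice_path m I) z)"
      using sub pos zero unfolding D_def nc_complex_def sum mem_Collect_eq by argo
    have supp: "I \<in> path_sets m L" if "c I \<noteq> 0" for I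
      using True zero that by blast
    have nonneg: "0 \<le> c I" for I using True by blast
    have "D F c \<longleftrightarrow> pairwise non_crossing F \<and>
        (\<forall>k t. t \<le> m \<longrightarrow> mass m c k t = row_sup L T k t)"
      by (rule trans[OF D conj_cong[OF refl decomposition_iff_mass[OF L T nonneg supp]]])
    then show ?thesis using True by blast
  qed
  obtain c where c: "\<And>I. 0 \<le> c I" "\<And>I. 0 < c I \<Longrightarrow> I \<in> path_sets m L"
    "\<And>I J. 0 < c I \<Longrightarrow> 0 < c J \<Longrightarrow> non_crossing I J"
    "\<And>k t. t \<le> m \<Longrightarrow> mass m c k t = row_sup L T k t"
    using weights_exist[OF L T] by metis
  have D_c: "D {I. 0 < c I} c" using c by (auto simp: D_iff pairwise_def)
  have uniq: "F' = {I. 0 < c I} \<and> c' = c" if D': "D F' c'" for F' c'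
  proof -
    have "c' I = c I" for I
    \<comment> \<open>Masses determine the weights of subsets of \<open>{1..m}\<close>; any other
      set has weight 0 because both supports lie in \<open>path_sets m L\<close>.\<close>
    proof (cases "I \<subseteq> {1..m}")
      case True
      then show ?thesis
        using D' c by (intro weights_unique[of c' m c]) (auto simp: D_iff pairwise_def)
    next
      case False
      then have "\<not> 0 < c' I" "\<not> 0 < c I" using D' c(2) by (auto simp: D_iff path_sets_def)
      then show ?thesis using D' c(1) by (metis D_iff order_antisym not_le)
    qed
    then have "c' = c" by blast
    then show ?thesis using D' by (simp add: D_iff)
  qed
  have "\<exists>!(F, c). D F c"
  proof (rule ex1I[of _ "({I. 0 < c I}, c)"])
    show "case ({I. 0 < c I}, c) of (F, c) \<Rightarrow> D F c" using D_c by simp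
    fix p assume p: "case p of (F, c) \<Rightarrow> D F c"
    then have "D (fst p) (snd p)" by (simp add: case_prod_beta)
    then show "p = ({I. 0 < c I}, c)" using uniq by (intro prod_eqI) auto
  qed
  then show "\<exists>!(F, c :: nat set \<Rightarrow> real).
    F \<in> nc_complex m L \<and>
    (\<forall>I \<in> F. c I > 0) \<and> (\<forall>I. I \<notin> F \<longrightarrow> c I = 0) \<and>
    T = (\<lambda>z. \<Sum>I\<in>F. c I * path_pattern L (lattice_path m I) z)"
    unfolding D_def .
qed

end
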